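(* Let $\chi$ be a probability distribution on $\mathbb{N}_0$ with $0<\chi(0)<1$. For every $k\in\mathbb{N}$: (i) $\chi(0)<n\ell_k\le c_k$; (ii) $m\ell_k\le\hat c_k$, where $\hat c_k$ is the unique point of intersection (i.e. the $x$-coordinate thereof) between the curves $y=F_k(x)$ and $y=J_k(x)+\chi(0)$ in $(0,c_{k-1})$; (iii) $nd_k>0$ if and only if $n\ell_k<c_k$; (iv) $md_k>0$ if and only if $m\ell_k<\hat c_k$.
   Context: $\mathbb{N}=\{1,2,\dots\}$, $\mathbb{N}_0=\mathbb{N}\cup\{0\}$. $G(x)=\sum_{m\ge 0}\chi(m)x^m$ on $[0,1]$. Games. $\mathcal{T}_\chi$ is the rooted Galton-Watson tree in which every vertex independently has a number of children distributed as $\chi$. For a vertex $u$, $\Gamma_i(u)$ is the set of descendants $v\neq u$ of $u$ at graph distance at most $i$ from $u$. In the $k$-jump games a token starts at a vertex; two players P1, P2 alternate (P1 first), and a move relocates the token from its current vertex $u$ to any vertex of $\Gamma_k(u)$. In the $k$-jump normal game a player unable to move loses; in the $k$-jump misère game a player unable to move wins. The tree is fully known to both players and both play optimally; a game that goes on forever is a draw. For the game started at the root of $\mathcal{T}_\chi$: $n\ell_k$, $nd_k$ are the probabilities that P1 loses, respectively that the game is a draw, in the $k$-jump normal game; $m\ell_k$, $md_k$ are the corresponding probabilities in the $k$-jump misère game. Functions $F_i$ and numbers $c_i$. $F_0(x)=1$ on $[0,1]$, $c_0=1$, and recursively for $i\in\mathbb{N}$, $F_i:[0,c_{i-1}]\to[0,1]$,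 $F_i(x)=G(F_{i-1}(x)-x)$, where $c_i$ is the unique fixed point of $F_i$ (it is known that $c_i$ exists, is unique, and $c_i<c_{i-1}$). Functions $\gamma_i$ and $J_k$. $\gamma_1(x,y)=x-y$ on $\mathbb{R}^2$, and for $i\ge2$, $$\gamma_i(x_0,x_1,\ldots,x_i)=G\big(\chi(0)+\gamma_{i-1}(x_0,x_2,\ldots,x_i)\big)-G\big(\chi(0)+\gamma_{i-1}(x_1,x_2,\ldots,x_i)\big),$$ defined where the two arguments of $G$ are defined and lie in $[0,1]$. For $x\in[0,c_{k-1}]$, $J_k(x)=G\big(\chi(0)+\gamma_k(F_0(x),F_1(x),\ldots,F_k(x))\big)-\chi(0)$. *)

theory Defs
  imports "HOL-Probability.Probability"
begin

section \<open>Two-player games on a graph\<close>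

text \<open>
  A game is given by its move function \<open>M\<close>: from position \<open>v\<close> the player to move may choose any
  element of \<open>M v\<close>.  A strategy sees the whole history of positions, oldest first, so that
  the current position is the last entry; it is never empty.
\<close>

datatype player = P1 | P2

fun opponent :: "player \<Rightarrow> player" where
  "opponent P1 = P2"
| "opponent P2 = P1"

type_synonym 'v strategy = "'v list \<Rightarrow> 'v"

definition legal_strategy :: "('v \<Rightarrow> 'v set) \<Rightarrow> 'v strategy \<Rightarrow> bool" where
  "legal_strategy M s \<longleftrightarrow>
     (\<forall>h. h \<noteq> [] \<longrightarrow> M (last h) \<noteq> {} \<longrightarrow> s h \<in> M (last h))"

definition player_to_move :: "nat \<Rightarrow> player" where
  "player_to_move n = (if even n then P1 else P2)"

text \<open>
  The history before turn \<open>n\<close> when P1 uses \<open>s\<close> and P2 uses \<open>t\<close>.  It is meaningful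
  only as long as no player has been stuck; \<open>gets_stuck\<close> inspects only this part.
\<close>

primrec history :: "'v strategy \<Rightarrow> 'v strategy \<Rightarrow> 'v \<Rightarrow> nat \<Rightarrow> 'v list" where
  "history s t v 0 = [v]"
| "history s t v (Suc n) =
     (let h = history s t v n
      in h @ [case player_to_move n of P1 \<Rightarrow> s h | P2 \<Rightarrow> t h])"

definition gets_stuck ::
    "('v \<Rightarrow> 'v set) \<Rightarrow> 'v strategy \<Rightarrow> 'v strategy \<Rightarrow> 'v \<Rightarrow> player \<Rightarrow> bool" where
  "gets_stuck M s t v p \<longleftrightarrow>
     (\<exists>n. player_to_move n = p \<and> M (last (history s t v n)) = {} \<and>
          (\<forall>m<n. M (last (history s t v m)) \<noteq> {}))"

datatype convention = Normal | Misere

text \<open>An infinite play is won by neither player.\<close>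

fun wins_play ::
    "convention \<Rightarrow> ('v \<Rightarrow> 'v set) \<Rightarrow> 'v strategy \<Rightarrow> 'v strategy \<Rightarrow> 'v \<Rightarrow> player \<Rightarrow> bool" where
  "wins_play Normal M s t v p = gets_stuck M s t v (opponent p)"
| "wins_play Misere M s t v p = gets_stuck M s t v p"

fun has_winning_strategy ::
    "convention \<Rightarrow> ('v \<Rightarrow> 'v set) \<Rightarrow> 'v \<Rightarrow> player \<Rightarrow> bool" where
  "has_winning_strategy g M v P1 =
     (\<exists>s. legal_strategy M s \<and> (\<forall>t. legal_strategy M t \<longrightarrow> wins_play g M s t v P1))"
| "has_winning_strategy g M v P2 =
     (\<exists>t. legal_strategy M t \<and> (\<forall>s. legal_strategy M s \<longrightarrow> wins_play g M s t v P2))"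

definition P1_loses :: "convention \<Rightarrow> ('v \<Rightarrow> 'v set) \<Rightarrow> 'v \<Rightarrow> bool" where
  "P1_loses g M v \<longleftrightarrow> has_winning_strategy g M v P2"

definition is_draw :: "convention \<Rightarrow> ('v \<Rightarrow> 'v set) \<Rightarrow> 'v \<Rightarrow> bool" where
  "is_draw g M v \<longleftrightarrow> (\<forall>p. \<not> has_winning_strategy g M v p)"


section \<open>The Galton-Watson tree and the jump games on it\<close>

text \<open>
  Ulam-Harris encoding: vertices are lists of naturals, the root is \<open>[]\<close>, and \<open>\<omega> u\<close> is the
  number of children of \<open>u\<close>, which are the \<open>u @ [j]\<close> with \<open>j < \<omega> u\<close>.  The values \<open>\<omega> u\<close> at all
  potential vertices \<open>u\<close> are independent with law \<open>\<xi>\<close>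
  (the offspring distribution; the letter chi is reserved syntax in HOL-Analysis).
\<close>

definition GW_measure :: "nat pmf \<Rightarrow> (nat list \<Rightarrow> nat) measure" where
  "GW_measure \<xi> = Pi\<^sub>M UNIV (\<lambda>_. measure_pmf \<xi>)"

inductive_set GW_tree :: "(nat list \<Rightarrow> nat) \<Rightarrow> nat list set" for \<omega> where
  root: "[] \<in> GW_tree \<omega>"
| child: "u \<in> GW_tree \<omega> \<Longrightarrow> j < \<omega> u \<Longrightarrow> u @ [j] \<in> GW_tree \<omega>"

definition jump_moves :: "nat \<Rightarrow> (nat list \<Rightarrow> nat) \<Rightarrow> nat list \<Rightarrow> nat list set" where
  "jump_moves k \<omega> u = {v \<in> GW_tree \<omega>. \<exists>w. v = u @ w \<and> w \<noteq> [] \<and> length w \<le> k}"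

definition loss_prob :: "convention \<Rightarrow> nat pmf \<Rightarrow> nat \<Rightarrow> real" where
  "loss_prob g \<xi> k = \<P>(\<omega> in GW_measure \<xi>. P1_loses g (jump_moves k \<omega>) [])"

definition draw_prob :: "convention \<Rightarrow> nat pmf \<Rightarrow> nat \<Rightarrow> real" where
  "draw_prob g \<xi> k = \<P>(\<omega> in GW_measure \<xi>. is_draw g (jump_moves k \<omega>) [])"


section \<open>The functions $F_i$, $\gamma_i$, $J_k$ and the numbers $c_i$, $\hat c_k$\<close>

text \<open>
  All functions are total here; only their values on the stated domains are meaningful:
  \<open>[0, 1]\<close> for \<open>G_fun\<close>, \<open>[0, c_num \<xi> (i - 1)]\<close> for \<open>F_fun \<xi> i\<close> with \<open>i \<ge> 1\<close>, and
  \<open>[0, c_num \<xi> (k - 1)]\<close> for \<open>J_fun \<xi> k\<close>.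
\<close>

definition G_fun :: "nat pmf \<Rightarrow> real \<Rightarrow> real" where
  "G_fun \<xi> x = (\<Sum>m. pmf \<xi> m * x ^ m)"

primrec F_fun :: "nat pmf \<Rightarrow> nat \<Rightarrow> real \<Rightarrow> real" where
  "F_fun \<xi> 0 x = 1"
| "F_fun \<xi> (Suc i) x = G_fun \<xi> (F_fun \<xi> i x - x)"

primrec c_num :: "nat pmf \<Rightarrow> nat \<Rightarrow> real" where
  "c_num \<xi> 0 = 1"
| "c_num \<xi> (Suc i) = (THE x. x \<in> {0..c_num \<xi> i} \<and> F_fun \<xi> (Suc i) x = x)"

text \<open>
  $\gamma_i(x_0, \ldots, x_i)$ is \<open>gamma_fun\<close> applied to the list of its \<open>i + 1 \<ge> 2\<close> arguments.
\<close>

fun gamma_fun :: "nat pmf \<Rightarrow> real list \<Rightarrow> real" where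
  "gamma_fun \<xi> [x, y] = x - y"
| "gamma_fun \<xi> (x # y # z # zs) =
     G_fun \<xi> (pmf \<xi> 0 + gamma_fun \<xi> (x # z # zs)) -
     G_fun \<xi> (pmf \<xi> 0 + gamma_fun \<xi> (y # z # zs))"

definition J_fun :: "nat pmf \<Rightarrow> nat \<Rightarrow> real \<Rightarrow> real" where
  "J_fun \<xi> k x =
     G_fun \<xi> (pmf \<xi> 0 + gamma_fun \<xi> (map (\<lambda>i. F_fun \<xi> i x) [0..<Suc k])) - pmf \<xi> 0"

definition meets_at :: "nat pmf \<Rightarrow> nat \<Rightarrow> real \<Rightarrow> bool" where
  "meets_at \<xi> k x \<longleftrightarrow>
     x \<in> {0<..<c_num \<xi> (k - 1)} \<and> F_fun \<xi> k x = J_fun \<xi> k x + pmf \<xi> 0"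

definition c_hat :: "nat pmf \<Rightarrow> nat \<Rightarrow> real" where
  "c_hat \<xi> k = (THE x. meets_at \<xi> k x)"

end

theory Submission
  imports Defs
begin

text \<open>
  Since every position has finitely many moves, "the player to move loses from \<open>v\<close>" is the union
  over \<open>n\<close> of "loses within \<open>n\<close> rounds", and this inductive notion agrees with the existence of a
  winning strategy: one direction plays towards positions that are lost in fewer rounds, the other
  never leaves the positions that the opponent cannot force.  So one may work with the sets
  of \<open>lost\<close> and \<open>won\<close> vertices, a position being lost iff all of its moves lead to won ones
  (and, in misere play, it has a move), and won iff some move leads to a lost one (or, in misere
  play, it has no move).

  Let \<open>x\<close> be the probability that the root is lost.  Everything rests on two facts.  The subtrees at
  the children of the root are independent copies of the whole tree, so an event that must hold
  in all of these subtrees has probability \<open>G p\<close> if it has probability \<open>p\<close> for one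
  (\<open>prob_all_children\<close>).  And a lost vertex has no lost descendant within distance \<open>k\<close>.  Let \<open>N\<^sub>i\<close> be the
  event that no vertex of $\Gamma_i$ of the root is lost.  Then \<open>N\<^sub>i\<^sub>+\<^sub>1\<close> says that for every child \<open>N\<^sub>i\<close> holds
  and the child is not lost; the second fact makes the probability of this, for one child,
  \<open>P(N\<^sub>i) - x\<close>, whence \<open>P(N\<^sub>i) = F\<^sub>i(x)\<close> (\<open>prob_none_lost\<close>).

  In the normal game the root is won iff \<open>N\<^sub>k\<close> fails, so a draw has probability \<open>F\<^sub>k(x) - x\<close>.  This is
  nonnegative, and as \<open>F\<^sub>k\<close> is strictly decreasing with fixed point \<open>c\<^sub>k\<close>, it follows that \<open>x \<le> c\<^sub>k\<close>, with
  equality iff draws have probability \<open>0\<close>.  That \<open>x\<close> exceeds the probability of a leaf is witnessed by trees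
  with all leaves at depth \<open>k + 1\<close>.

  In the misere game leaves are won, so a draw has probability \<open>F\<^sub>k(x) - x - \<xi>(0)\<close>.  By \<open>prob_gamma_F\<close>,
  \<open>J\<^sub>k(x)\<close> is the probability that the root is not a leaf and every vertex of its $\Gamma_k$ is won.  But
  this means that the root is lost, so \<open>J\<^sub>k(x) = x\<close> (\<open>J_fun_loss\<close>).  Hence a draw has probability
  \<open>F\<^sub>k(x) - (J\<^sub>k(x) + \<xi>(0))\<close>, the gap at \<open>x\<close> between the two curves whose intersection is $\hat c_k$.
  Convexity of \<open>G\<close> makes \<open>J\<^sub>k\<close> nondecreasing (\<open>gamma_F_mono\<close>), so the gap is strictly decreasing; it changes
  sign on \<open>[0, c\<^sub>k\<^sub>-\<^sub>1]\<close>, and its sign at \<open>x\<close> tells on which side of $\hat c_k$ the point \<open>x\<close> lies.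
\<close>

section \<open>Lost and won positions of a game with finitely many moves\<close>

text \<open>
  A round consists of one move by each player, so \<open>n\<close> bounds the length of the play by \<open>2 n\<close>.
  Counting rounds with a natural number, rather than taking a least fixed point at once, makes
  measurability and the passage to subtrees plain inductions.
\<close>
primrec loses_in :: "convention \<Rightarrow> ('v \<Rightarrow> 'v set) \<Rightarrow> nat \<Rightarrow> 'v \<Rightarrow> bool" where
  "loses_in g M 0 v = False"
| "loses_in g M (Suc n) v \<longleftrightarrow>
     (g = Misere \<longrightarrow> M v \<noteq> {}) \<and>
     (\<forall>u\<in>M v. g = Misere \<and> M u = {} \<or> (\<exists>w\<in>M u. loses_in g M n w))"

definition lost :: "convention \<Rightarrow> ('v \<Rightarrow> 'v set) \<Rightarrow> 'v \<Rightarrow> bool" where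
  "lost g M v \<longleftrightarrow> (\<exists>n. loses_in g M n v)"

definition won :: "convention \<Rightarrow> ('v \<Rightarrow> 'v set) \<Rightarrow> 'v \<Rightarrow> bool" where
  "won g M v \<longleftrightarrow> g = Misere \<and> M v = {} \<or> (\<exists>u\<in>M v. lost g M u)"

lemma loses_in_Suc: "loses_in g M n v \<Longrightarrow> loses_in g M (Suc n) v"
proof (induction n arbitrary: v)
  case (Suc n)
  have step: "g = Misere \<and> M u = {} \<or> (\<exists>w\<in>M u. loses_in g M (Suc n) w)"
    if "g = Misere \<and> M u = {} \<or> (\<exists>w\<in>M u. loses_in g M n w)" for u
    using that
  proof
    assume "\<exists>w\<in>M u. loses_in g M n w"
    then obtain w where "w \<in> M u" "loses_in g M n w" ..
    with Suc.IH[of w] show ?thesis by blast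
  qed blast
  from Suc.prems have stuck: "g = Misere \<longrightarrow> M v \<noteq> {}"
    and "\<forall>u\<in>M v. g = Misere \<and> M u = {} \<or> (\<exists>w\<in>M u. loses_in g M n w)"
    unfolding loses_in.simps(2) by (rule conjunct1, rule conjunct2)
  then have "\<forall>u\<in>M v. g = Misere \<and> M u = {} \<or> (\<exists>w\<in>M u. loses_in g M (Suc n) w)"
    using step by (intro ballI) (drule (1) bspec, rule step)
  with stuck show ?case unfolding loses_in.simps(2)[of g M "Suc n"] by (rule conjI)
qed (simp only: loses_in.simps(1))

lemma loses_in_mono: "loses_in g M m v \<Longrightarrow> m \<le> n \<Longrightarrow> loses_in g M n v"
  using lift_Suc_mono_le[of "\<lambda>n. loses_in g M n v" m n] loses_in_Suc[of g M _ v]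
  by (auto simp del: loses_in.simps)

text \<open>
  Finiteness enters here: the bounds on the number of rounds for the individual moves have a
  common maximum.
\<close>
lemma lost_iff:
  assumes "finite (M v)"
  shows "lost g M v \<longleftrightarrow> (g = Misere \<longrightarrow> M v \<noteq> {}) \<and> (\<forall>u\<in>M v. won g M u)"
proof
  assume "lost g M v"
  then obtain n where n: "loses_in g M n v" by (auto simp: lost_def)
  then obtain m where "n = Suc m" by (cases n) auto
  with n show "(g = Misere \<longrightarrow> M v \<noteq> {}) \<and> (\<forall>u\<in>M v. won g M u)"
    by (auto simp: won_def lost_def)
next
  assume *: "(g = Misere \<longrightarrow> M v \<noteq> {}) \<and> (\<forall>u\<in>M v. won g M u)"
  then have "\<forall>u\<in>M v. \<exists>n. g = Misere \<and> M u = {} \<or> (\<exists>w\<in>M u. loses_in g M n w)"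
    by (auto simp: won_def lost_def)
  then obtain r where
    r: "\<And>u. u \<in> M v \<Longrightarrow> g = Misere \<and> M u = {} \<or> (\<exists>w\<in>M u. loses_in g M (r u) w)"
    by metis
  define n where "n = Max (insert 0 (r ` M v))"
  have "r u \<le> n" if "u \<in> M v" for u
    using assms that by (auto simp: n_def)
  then have "loses_in g M (Suc n) v"
    using * r by simp (meson loses_in_mono)
  then show "lost g M v" unfolding lost_def by blast
qed

text \<open>
  If \<open>v\<close> were both, then a lost move \<open>u\<close> from \<open>v\<close> would be answered by a position \<open>w\<close> that is lost in
  fewer rounds than \<open>v\<close> and, as a move from a lost position, also won.
\<close>
lemma lost_imp_not_won:
  assumes fin: "\<And>v. finite (M v)"
  shows "lost g M v \<Longrightarrow> \<not> won g M v"
proof -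
  have "loses_in g M n v \<Longrightarrow> \<not> won g M v" for n
  proof (induction n arbitrary: v)
    case (Suc n)
    show ?case
    proof
      assume "won g M v"
      then obtain u where u: "u \<in> M v" "lost g M u"
        using Suc.prems by (auto simp: won_def)
      have "\<not> (g = Misere \<and> M u = {})" and won: "\<forall>w\<in>M u. won g M w"
        using u(2) lost_iff[of M u g] fin by blast+
      then obtain w where "w \<in> M u" "loses_in g M n w"
        using Suc.prems u(1) unfolding loses_in.simps by blast
      then show False using Suc.IH won by blast
    qed
  qed simp
  then show "lost g M v \<Longrightarrow> \<not> won g M v" by (auto simp: lost_def)
qed

text \<open>
  One positional strategy serves all purposes.  Moving to a lost position is not enough to win,
  since the play might go on forever; the move has to minimise the number of remaining
  rounds.  Without such a move, the best is to deny the opponent a won position.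
\<close>
definition best_move :: "convention \<Rightarrow> ('v \<Rightarrow> 'v set) \<Rightarrow> 'v \<Rightarrow> 'v" where
  "best_move g M u =
     (if \<exists>w\<in>M u. lost g M w
      then SOME w. w \<in> M u \<and> loses_in g M (LEAST n. \<exists>w\<in>M u. loses_in g M n w) w
      else if \<exists>w\<in>M u. \<not> won g M w then SOME w. w \<in> M u \<and> \<not> won g M w
      else SOME w. w \<in> M u)"

lemma best_move_loses_in:
  assumes "w \<in> M u" "loses_in g M n w"
  shows "best_move g M u \<in> M u \<and> loses_in g M n (best_move g M u)"
proof -
  let ?n = "LEAST n. \<exists>w\<in>M u. loses_in g M n w"
  have ex: "\<exists>w. w \<in> M u \<and> loses_in g M ?n w"
    using LeastI_ex[of "\<lambda>n. \<exists>w\<in>M u. loses_in g M n w"] assms by blast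
  have "?n \<le> n" using assms by (intro Least_le) blast
  moreover have "best_move g M u = (SOME w. w \<in> M u \<and> loses_in g M ?n w)"
    unfolding best_move_def using assms by (auto simp: lost_def)
  ultimately show ?thesis
    using someI_ex[OF ex] loses_in_mono by metis
qed

lemma best_move_not_won:
  assumes fin: "\<And>v. finite (M v)" and "w \<in> M u" "\<not> won g M w"
  shows "best_move g M u \<in> M u \<and> \<not> won g M (best_move g M u)"
proof (cases "\<exists>w\<in>M u. lost g M w")
  case True
  then obtain n w where "w \<in> M u" "loses_in g M n w" by (auto simp: lost_def)
  from best_move_loses_in[OF this] have "best_move g M u \<in> M u" "lost g M (best_move g M u)"
    by (auto simp: lost_def)
  then show ?thesis using lost_imp_not_won[of M g, OF fin] by blast
next
  case False
  then have "best_move g M u = (SOME w. w \<in> M u \<and> \<not> won g M w)"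
    unfolding best_move_def using assms by auto
  then show ?thesis using someI_ex[of "\<lambda>w. w \<in> M u \<and> \<not> won g M w"] assms by auto
qed

lemma best_move_legal:
  assumes "M u \<noteq> {}"
  shows "best_move g M u \<in> M u"
proof -
  consider n w where "w \<in> M u" "loses_in g M n w"
    | "\<not> (\<exists>w\<in>M u. lost g M w)" "\<exists>w\<in>M u. \<not> won g M w"
    | "\<not> (\<exists>w\<in>M u. lost g M w)" "\<not> (\<exists>w\<in>M u. \<not> won g M w)"
    unfolding lost_def by blast
  then show ?thesis
  proof cases
    case 1
    then show ?thesis using best_move_loses_in by metis
  next
    case 2
    then have "best_move g M u = (SOME w. w \<in> M u \<and> \<not> won g M w)"
      unfolding best_move_def by (simp only: if_False if_True)
    then show ?thesis using someI_ex[of "\<lambda>w. w \<in> M u \<and> \<not> won g M w"] 2(2) by auto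
  next
    case 3
    then have "best_move g M u = (SOME w. w \<in> M u)"
      unfolding best_move_def by (simp only: if_False)
    then show ?thesis using some_in_eq[of "M u"] assms by simp
  qed
qed

definition play :: "'v strategy \<Rightarrow> 'v strategy \<Rightarrow> 'v \<Rightarrow> nat \<Rightarrow> 'v" where
  "play s t v n = last (history s t v n)"

lemma history_not_Nil: "history s t v n \<noteq> []"
  by (cases n) (auto simp: Let_def)

lemma play_0: "play s t v 0 = v"
  by (simp add: play_def)

lemma play_Suc:
  "play s t v (Suc n) =
     (case player_to_move n of P1 \<Rightarrow> s (history s t v n) | P2 \<Rightarrow> t (history s t v n))"
  by (simp add: play_def Let_def)

lemma play_legal:
  assumes "legal_strategy M s" "legal_strategy M t" "M (play s t v n) \<noteq> {}"
  shows "play s t v (Suc n) \<in> M (play s t v n)"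
  using assms history_not_Nil[of s t v n]
  unfolding legal_strategy_def play_Suc play_def[of s t v n]
  by (auto split: player.splits)

lemma gets_stuck_play:
  "gets_stuck M s t v p \<longleftrightarrow>
     (\<exists>n. player_to_move n = p \<and> M (play s t v n) = {} \<and> (\<forall>m<n. M (play s t v m) \<noteq> {}))"
  by (simp add: gets_stuck_def play_def)

lemma wins_play_iff:
  "wins_play g M s t v p \<longleftrightarrow> gets_stuck M s t v (case g of Normal \<Rightarrow> opponent p | Misere \<Rightarrow> p)"
  by (cases g) auto

lemma player_to_move_Suc: "player_to_move (Suc n) = opponent (player_to_move n)"
  by (simp add: player_to_move_def)

lemma opponent_opponent: "opponent (opponent p) = p"
  by (cases p) auto

lemma opponent_neq: "opponent p \<noteq> p" "p \<noteq> opponent p"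
  by (cases p; simp)+

lemma not_player_iff: "p \<noteq> q \<longleftrightarrow> p = opponent q"
  by (cases p; cases q; simp)

text \<open>
  Play by \<open>best_move\<close> lowers the number of remaining rounds each time the opponent is to move.
\<close>
lemma best_play_wins:
  assumes legal: "legal_strategy M s" "legal_strategy M t"
    and best: "\<And>n. player_to_move n = q \<Longrightarrow> play s t v (Suc n) = best_move g M (play s t v n)"
    and "player_to_move n = opponent q" "\<And>m. m < n \<Longrightarrow> M (play s t v m) \<noteq> {}"
    and "loses_in g M r (play s t v n)"
  shows "wins_play g M s t v q"
  using assms(4-6)
proof (induction r arbitrary: n)
  case (Suc r)
  show ?case
  proof (cases "M (play s t v n) = {}")
    case True
    then have "g = Normal" using Suc.prems(3) by (cases g) auto
    then show ?thesis
      using True Suc.prems by (auto simp: gets_stuck_play)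
  next
    case False
    let ?u = "play s t v (Suc n)"
    have u: "?u \<in> M (play s t v n)" using play_legal[OF legal False] .
    have turn: "player_to_move (Suc n) = q"
      using Suc.prems(1) by (simp add: player_to_move_Suc opponent_opponent)
    have before: "M (play s t v m) \<noteq> {}" if "m < Suc n" for m
      using that False Suc.prems(2) by (auto simp: less_Suc_eq)
    show ?thesis
    proof (cases "M ?u = {}")
      case True
      then have "g = Misere" using Suc.prems(3) u by auto
      then show ?thesis using True turn before by (auto simp: gets_stuck_play)
    next
      case False
      then obtain w where "w \<in> M ?u" "loses_in g M r w"
        using Suc.prems(3) u unfolding loses_in.simps by blast
      from best_move_loses_in[OF this] have "loses_in g M r (play s t v (Suc (Suc n)))"
        using best[OF turn] by simp
      moreover have "player_to_move (Suc (Suc n)) = opponent q"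
        using turn by (simp add: player_to_move_Suc)
      moreover have "M (play s t v m) \<noteq> {}" if "m < Suc (Suc n)" for m
        using that False before by (auto simp: less_Suc_eq)
      ultimately show ?thesis using Suc.IH by blast
    qed
  qed
qed simp

text \<open>
  The player using \<open>best_move\<close> here is the opponent of \<open>q\<close>; the invariant is that \<open>q\<close> never moves from a won
  position and the opponent never from a lost one.  A play that ends in \<open>q\<close>'s favour would end at
  a position violating it.
\<close>
lemma best_play_avoids_loss:
  assumes fin: "\<And>v. finite (M v)"
    and legal: "legal_strategy M s" "legal_strategy M t"
    and best: "\<And>n. player_to_move n = opponent q \<Longrightarrow>
                 play s t v (Suc n) = best_move g M (play s t v n)"
    and start: "if player_to_move 0 = q then \<not> won g M v else \<not> lost g M v"
  shows "\<not> wins_play g M s t v q"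
proof -
  have inv: "if player_to_move n = q then \<not> won g M (play s t v n) else \<not> lost g M (play s t v n)"
    if "\<And>m. m < n \<Longrightarrow> M (play s t v m) \<noteq> {}" for n
    using that
  proof (induction n)
    case 0
    then show ?case using start by (simp add: play_0)
  next
    case (Suc n)
    have ne: "M (play s t v n) \<noteq> {}" and
      IH: "if player_to_move n = q then \<not> won g M (play s t v n) else \<not> lost g M (play s t v n)"
      using Suc by auto
    show ?case
    proof (cases "player_to_move n = q")
      case True
      then show ?thesis
        using IH play_legal[OF legal ne]
        by (auto simp: player_to_move_Suc opponent_neq won_def)
    next
      case False
      then have q: "player_to_move n = opponent q" by (simp add: not_player_iff)
      obtain w where "w \<in> M (play s t v n)" "\<not> won g M w"
        using IH False ne lost_iff[of M "play s t v n" g, OF fin] by auto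
      from best_move_not_won[of M, OF fin this] show ?thesis
        using best[OF q] q by (simp add: player_to_move_Suc opponent_opponent)
    qed
  qed
  show ?thesis
  proof
    assume "wins_play g M s t v q"
    then obtain n where n: "player_to_move n = (case g of Normal \<Rightarrow> opponent q | Misere \<Rightarrow> q)"
        "M (play s t v n) = {}" "\<forall>m<n. M (play s t v m) \<noteq> {}"
      unfolding wins_play_iff gets_stuck_play by blast
    show False
      using inv[of n] n lost_iff[of M "play s t v n" g, OF fin]
      by (cases g) (auto simp: won_def opponent_neq)
  qed
qed

lemma best_move_legal_strategy: "legal_strategy M (\<lambda>h. best_move g M (last h))"
  by (simp add: legal_strategy_def best_move_legal)

lemma play_best:
  "player_to_move n = P1 \<Longrightarrow>
     play (\<lambda>h. best_move g M (last h)) t v (Suc n) =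
     best_move g M (play (\<lambda>h. best_move g M (last h)) t v n)"
  "player_to_move n = P2 \<Longrightarrow>
     play s (\<lambda>h. best_move g M (last h)) v (Suc n) =
     best_move g M (play s (\<lambda>h. best_move g M (last h)) v n)"
  unfolding play_Suc by (simp_all only: play_def player.case)

lemma has_winning_strategy_P1_iff:
  assumes fin: "\<And>v. finite (M v)"
  shows "has_winning_strategy g M v P1 \<longleftrightarrow> won g M v"
proof
  let ?b = "\<lambda>h. best_move g M (last h)"
  assume "has_winning_strategy g M v P1"
  then obtain s where s: "legal_strategy M s" "\<And>t. legal_strategy M t \<Longrightarrow> wins_play g M s t v P1"
    unfolding has_winning_strategy.simps by blast
  show "won g M v"
  proof (rule ccontr)
    assume "\<not> won g M v"
    then have "\<not> wins_play g M s ?b v P1"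
      using play_best(2)[of _ s g M v]
      by (intro best_play_avoids_loss[OF fin s(1) best_move_legal_strategy])
         (auto simp: player_to_move_def)
    then show False using s(2) best_move_legal_strategy by blast
  qed
next
  let ?b = "\<lambda>h. best_move g M (last h)"
  assume won: "won g M v"
  have "wins_play g M ?b t v P1" if t: "legal_strategy M t" for t
  proof (cases "M v = {}")
    case True
    then show ?thesis
      using won by (auto simp: won_def gets_stuck_play player_to_move_def play_0 intro!: exI[of _ 0])
  next
    case False
    then obtain w r where "w \<in> M v" "loses_in g M r w"
      using won by (auto simp: won_def lost_def)
    from best_move_loses_in[OF this] have "loses_in g M r (play ?b t v 1)"
      using play_best(1)[of 0 g M t v] by (simp add: player_to_move_def play_0)
    then show ?thesis
      using False play_best(1)[of _ g M t v]
      by (intro best_play_wins[OF best_move_legal_strategy t, where n=1])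
         (auto simp: player_to_move_def play_0)
  qed
  then show "has_winning_strategy g M v P1"
    using best_move_legal_strategy unfolding has_winning_strategy.simps by blast
qed

lemma has_winning_strategy_P2_iff:
  assumes fin: "\<And>v. finite (M v)"
  shows "has_winning_strategy g M v P2 \<longleftrightarrow> lost g M v"
proof
  let ?b = "\<lambda>h. best_move g M (last h)"
  assume "has_winning_strategy g M v P2"
  then obtain t where t: "legal_strategy M t" "\<And>s. legal_strategy M s \<Longrightarrow> wins_play g M s t v P2"
    unfolding has_winning_strategy.simps by blast
  show "lost g M v"
  proof (rule ccontr)
    assume "\<not> lost g M v"
    then have "\<not> wins_play g M ?b t v P2"
      using play_best(1)[of _ g M t v]
      by (intro best_play_avoids_loss[OF fin best_move_legal_strategy t(1)])
         (auto simp: player_to_move_def)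
    then show False using t(2) best_move_legal_strategy by blast
  qed
next
  let ?b = "\<lambda>h. best_move g M (last h)"
  assume "lost g M v"
  then obtain r where r: "loses_in g M r v" by (auto simp: lost_def)
  have "wins_play g M s ?b v P2" if s: "legal_strategy M s" for s
    using r play_best(2)[of _ s g M v]
    by (intro best_play_wins[OF s best_move_legal_strategy, where n=0])
       (auto simp: player_to_move_def play_0)
  then show "has_winning_strategy g M v P2"
    using best_move_legal_strategy unfolding has_winning_strategy.simps by blast
qed

lemma P1_loses_iff: "(\<And>v. finite (M v)) \<Longrightarrow> P1_loses g M v \<longleftrightarrow> lost g M v"
  unfolding P1_loses_def by (rule has_winning_strategy_P2_iff)

lemma is_draw_iff:
  "(\<And>v. finite (M v)) \<Longrightarrow> is_draw g M v \<longleftrightarrow> \<not> lost g M v \<and> \<not> won g M v"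
  unfolding is_draw_def
  by (metis has_winning_strategy_P1_iff has_winning_strategy_P2_iff player.exhaust)


section \<open>Analysis of the generating function and of the two curves\<close>

locale offspring =
  fixes \<xi> :: "nat pmf"
  assumes leaf_pos: "0 < pmf \<xi> 0" and leaf_less_1: "pmf \<xi> 0 < 1"
begin

abbreviation leaf_prob :: real where "leaf_prob \<equiv> pmf \<xi> 0"
abbreviation G :: "real \<Rightarrow> real" where "G \<equiv> G_fun \<xi>"
abbreviation F :: "nat \<Rightarrow> real \<Rightarrow> real" where "F \<equiv> F_fun \<xi>"
abbreviation c :: "nat \<Rightarrow> real" where "c \<equiv> c_num \<xi>"

lemma pmf_sums_1: "pmf \<xi> sums 1"
proof -
  have "summable (pmf \<xi>)"
    using pmf_abs_summable[of \<xi> UNIV] by (simp add: abs_summable_on_nat_iff')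
  moreover have "suminf (pmf \<xi>) = 1"
    using infsetsum_nat'[OF pmf_abs_summable[of \<xi> UNIV]] infsetsum_pmf_eq_1[of \<xi> UNIV] by simp
  ultimately show ?thesis by (simp add: sums_iff)
qed

lemma G_summable:
  assumes "0 \<le> x" "x \<le> 1"
  shows "summable (\<lambda>m. pmf \<xi> m * x ^ m)"
  using sums_summable[OF pmf_sums_1]
  by (rule summable_comparison_test'[where N=0])
     (use assms in \<open>auto simp: abs_mult power_abs mult_left_le power_le_one\<close>)

lemma G_0 [simp]: "G 0 = leaf_prob"
  unfolding G_fun_def by (subst suminf_finite[of "{0}"]) (auto simp: power_0_left)

lemma G_1 [simp]: "G 1 = 1"
  unfolding G_fun_def using pmf_sums_1 by (simp add: sums_iff)

text \<open>
  It suffices to raise the lower end from \<open>b'\<close> to the \<open>d\<close> with \<open>a' - d = a - b\<close>; then the factorisation of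
  a difference of powers compares the two sides factor by factor.
\<close>
lemma power_diff_le_power_diff:
  fixes a b a' b' :: real
  assumes "0 \<le> b'" "b' \<le> b + (a' - a)" "0 \<le> b" "b \<le> a" "a \<le> a'"
  shows "a ^ m - b ^ m \<le> a' ^ m - b' ^ m"
proof -
  define d where "d = b + (a' - a)"
  have d: "b \<le> d" "d \<le> a'" "b' \<le> d" "a' - d = a - b" using assms by (auto simp: d_def)
  have "a ^ m - b ^ m = (a - b) * (\<Sum>i<m. b ^ (m - Suc i) * a ^ i)"
    by (rule power_diff_sumr2)
  also have "\<dots> \<le> (a' - d) * (\<Sum>i<m. d ^ (m - Suc i) * a' ^ i)"
    using assms d by (intro mult_mono sum_mono power_mono sum_nonneg) auto
  also have "\<dots> = a' ^ m - d ^ m"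
    by (rule power_diff_sumr2[symmetric])
  also have "\<dots> \<le> a' ^ m - b' ^ m"
    using assms d by (intro diff_left_mono power_mono)
  finally show ?thesis .
qed

text \<open>
  Convexity and monotonicity of \<open>G\<close> together: an increment over an interval does not shrink when the
  upper end moves up and the length does not decrease.  It holds for each monomial.
\<close>
lemma G_diff_mono:
  assumes "0 \<le> b'" "b' \<le> b + (a' - a)" "0 \<le> b" "b \<le> a" "a \<le> a'" "a' \<le> 1"
  shows "G a - G b \<le> G a' - G b'"
proof -
  have "G u - G v = (\<Sum>m. pmf \<xi> m * (u ^ m - v ^ m))"
    and "summable (\<lambda>m. pmf \<xi> m * (u ^ m - v ^ m))"
    if "0 \<le> u" "u \<le> 1" "0 \<le> v" "v \<le> 1" for u v
    using that G_summable
    by (auto simp: G_fun_def suminf_diff right_diff_distrib summable_diff)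
  moreover have "a \<le> 1" "b \<le> 1" "b' \<le> 1" "0 \<le> a" "0 \<le> a'" using assms by auto
  ultimately show ?thesis
    using assms power_diff_le_power_diff[of b' b a' a]
    by (simp only:) (intro suminf_le mult_left_mono; simp)
qed

lemma G_mono: "0 \<le> x \<Longrightarrow> x \<le> y \<Longrightarrow> y \<le> 1 \<Longrightarrow> G x \<le> G y"
  using G_diff_mono[of x x y x] by simp

lemma G_ge_leaf: "0 \<le> x \<Longrightarrow> x \<le> 1 \<Longrightarrow> leaf_prob \<le> G x"
  using G_mono[of 0 x] by simp

lemma G_le_1: "0 \<le> x \<Longrightarrow> x \<le> 1 \<Longrightarrow> G x \<le> 1"
  using G_mono[of x 1] by simp

lemma nonleaf_support: obtains m where "m > 0" "pmf \<xi> m > 0"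
proof -
  have "\<exists>m>0. pmf \<xi> m > 0"
  proof (rule ccontr)
    assume "\<not> ?thesis"
    then have "pmf \<xi> m = 0" if "m \<noteq> 0" for m
      using that pmf_nonneg[of \<xi> m] by (metis antisym_conv1 neq0_conv)
    then have "G 1 = G 0"
      unfolding G_fun_def by (subst (1 2) suminf_finite[of "{0}"]) auto
    then show False using leaf_less_1 by simp
  qed
  then show ?thesis using that by blast
qed

lemma G_strict_mono: "0 \<le> x \<Longrightarrow> x < y \<Longrightarrow> y \<le> 1 \<Longrightarrow> G x < G y"
proof -
  assume xy: "0 \<le> x" "x < y" "y \<le> 1"
  obtain m where m: "m > 0" "pmf \<xi> m > 0" by (rule nonleaf_support)
  have sum: "summable (\<lambda>m. pmf \<xi> m * y ^ m - pmf \<xi> m * x ^ m)"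
    using G_summable xy by (intro summable_diff) auto
  have "0 < (\<Sum>m. pmf \<xi> m * y ^ m - pmf \<xi> m * x ^ m)"
    using xy m
    by (intro suminf_pos2[OF sum, where i=m])
       (auto intro!: mult_left_mono power_mono power_strict_mono)
  also have "\<dots> = G y - G x"
    unfolding G_fun_def using G_summable xy by (intro suminf_diff[symmetric]) auto
  finally show ?thesis by simp
qed

lemma continuous_on_G: "continuous_on {0..1} G"
proof -
  have "uniform_limit {0..1} (\<lambda>n x. \<Sum>m<n. pmf \<xi> m * x ^ m) (\<lambda>x. \<Sum>m. pmf \<xi> m * x ^ m) sequentially"
    using sums_summable[OF pmf_sums_1]
    by (rule Weierstrass_m_test[rotated]) (auto simp: abs_mult power_abs mult_left_le power_le_one)
  then show ?thesis
    unfolding G_fun_def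
    by (rule uniform_limit_theorem[rotated]) (auto intro!: always_eventually continuous_intros)
qed

lemma continuous_on_G_comp:
  "continuous_on A f \<Longrightarrow> (\<And>x. x \<in> A \<Longrightarrow> 0 \<le> f x \<and> f x \<le> 1) \<Longrightarrow> continuous_on A (\<lambda>x. G (f x))"
  by (rule continuous_on_compose2[OF continuous_on_G]) auto

text \<open>
  The stage-\<open>i\<close> properties that the construction of \<open>c (Suc i)\<close> and the properties of \<open>F (Suc i)\<close> on its
  domain \<open>{0..c i}\<close> rely on.  They are bundled because each stage is needed to justify the next.
\<close>
definition well_behaved :: "nat \<Rightarrow> bool" where
  "well_behaved i \<longleftrightarrow> leaf_prob \<le> c i \<and> F i (c i) = c i \<and>
     antimono_on {0..c i} (F i) \<and> continuous_on {0..c i} (F i) \<and> (\<forall>x\<in>{0..c i}. F i x \<le> 1)"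

lemma well_behaved_antimono:
  "well_behaved i \<Longrightarrow> 0 \<le> x \<Longrightarrow> x \<le> y \<Longrightarrow> y \<le> c i \<Longrightarrow> F i y \<le> F i x"
  unfolding well_behaved_def monotone_on_def by auto

lemma F_Suc_arg:
  assumes "well_behaved i" "x \<in> {0..c i}"
  shows "0 \<le> F i x - x" "F i x - x \<le> 1"
proof -
  have "0 \<le> x" "x \<le> c i" "F i x \<le> 1" using assms by (auto simp: well_behaved_def)
  moreover have "F i (c i) \<le> F i x" "F i (c i) = c i"
    using assms well_behaved_antimono[of i x "c i"] by (auto simp: well_behaved_def)
  ultimately show "0 \<le> F i x - x" "F i x - x \<le> 1" by auto
qed

lemma F_Suc_strict_antimono:
  assumes "well_behaved i" "0 \<le> x" "x < y" "y \<le> c i"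
  shows "F (Suc i) y < F (Suc i) x"
proof -
  have "F i y \<le> F i x" using well_behaved_antimono assms by simp
  then show ?thesis
    using assms F_Suc_arg[OF assms(1), of x] F_Suc_arg[OF assms(1), of y]
    by (simp add: G_strict_mono)
qed

lemma F_Suc_continuous: "well_behaved i \<Longrightarrow> continuous_on {0..c i} (F (Suc i))"
  by (simp, intro continuous_on_G_comp continuous_on_diff continuous_on_id)
     (use F_Suc_arg[of i] in \<open>auto simp: well_behaved_def simp del: F_fun.simps\<close>)

lemma F_at_0 [simp]: "F i 0 = 1"
  by (induction i) auto

lemma F_Suc_at_c: "well_behaved i \<Longrightarrow> F (Suc i) (c i) = leaf_prob"
  by (simp add: well_behaved_def)

lemma c_Suc:
  assumes "well_behaved i"
  shows "c (Suc i) \<in> {0..c i}" "F (Suc i) (c (Suc i)) = c (Suc i)"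
proof -
  have pos: "0 \<le> c i" using assms leaf_pos by (auto simp: well_behaved_def)
  have "\<exists>x\<ge>0. x \<le> c i \<and> F (Suc i) x - x = 0"
    using assms pos F_Suc_at_c[OF assms]
    by (intro IVT2' continuous_on_diff F_Suc_continuous continuous_on_id)
       (auto simp: well_behaved_def simp del: F_fun.simps(2))
  then have ex: "\<exists>x. x \<in> {0..c i} \<and> F (Suc i) x = x" by (auto simp del: F_fun.simps)
  have uniq: "x = y" if "x \<in> {0..c i} \<and> F (Suc i) x = x" "y \<in> {0..c i} \<and> F (Suc i) y = y" for x y
    using that F_Suc_strict_antimono[OF assms, of x y] F_Suc_strict_antimono[OF assms, of y x]
    by (cases x y rule: linorder_cases) (auto simp del: F_fun.simps)
  have "c (Suc i) \<in> {0..c i} \<and> F (Suc i) (c (Suc i)) = c (Suc i)"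
    unfolding c_num.simps(2)
    by (rule theI') (use ex uniq in blast)
  then show "c (Suc i) \<in> {0..c i}" "F (Suc i) (c (Suc i)) = c (Suc i)" by blast+
qed

lemma well_behaved: "well_behaved i"
proof (induction i)
  case 0
  show ?case using leaf_less_1 by (auto simp: well_behaved_def monotone_on_def)
next
  case (Suc i)
  note c = c_Suc[OF Suc]
  have "leaf_prob \<le> c (Suc i)"
    using G_ge_leaf[OF F_Suc_arg[OF Suc c(1)]] c(2) by simp
  moreover have "antimono_on {0..c (Suc i)} (F (Suc i))"
  proof (rule monotone_onI)
    fix x y assume "x \<in> {0..c (Suc i)}" "y \<in> {0..c (Suc i)}" "x \<le> y"
    then show "F (Suc i) y \<le> F (Suc i) x"
      using F_Suc_strict_antimono[OF Suc, of x y] c(1)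
      by (cases "x = y") (auto simp del: F_fun.simps)
  qed
  moreover have "continuous_on {0..c (Suc i)} (F (Suc i))"
    using F_Suc_continuous[OF Suc] by (rule continuous_on_subset) (use c(1) in auto)
  moreover have "\<forall>x\<in>{0..c (Suc i)}. F (Suc i) x \<le> 1"
    using G_le_1[OF F_Suc_arg[OF Suc]] c(1) by auto
  ultimately show ?case using c(2) unfolding well_behaved_def by blast
qed

lemma c_ge_leaf: "leaf_prob \<le> c i"
  using well_behaved[of i] by (simp add: well_behaved_def)

lemma c_decreasing: "i \<le> j \<Longrightarrow> c j \<le> c i"
  by (rule lift_Suc_antimono_le[of c]) (use c_Suc(1)[OF well_behaved] in auto)

text \<open>
  As \<open>F (Suc i)\<close> decreases strictly, the sign of \<open>F (Suc i) x - x\<close> tells on which side of the fixed point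
  \<open>x\<close> lies.  This turns nonnegativity of a draw probability into a bound on a loss probability.
\<close>
lemma F_fixed_point_iff:
  assumes "x \<in> {0..c i}"
  shows "x \<le> F (Suc i) x \<longleftrightarrow> x \<le> c (Suc i)" "x < F (Suc i) x \<longleftrightarrow> x < c (Suc i)"
  using assms F_Suc_strict_antimono[OF well_behaved, of x "c (Suc i)" i]
    F_Suc_strict_antimono[OF well_behaved, of "c (Suc i)" x i] c_Suc[OF well_behaved, of i]
  by (cases x "c (Suc i)" rule: linorder_cases; auto simp del: F_fun.simps c_num.simps)+

lemma F_antimono_index:
  assumes "k \<ge> 1" "x \<in> {0..c (k - 1)}" "i \<le> j" "j \<le> k"
  shows "F j x \<le> F i x"
proof -
  have arg: "0 \<le> F i x - x \<and> F i x - x \<le> 1" if "i < k" for i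
  proof -
    have "c (k - 1) \<le> c i" using that by (intro c_decreasing) simp
    then show ?thesis using F_Suc_arg[OF well_behaved, of x i] assms(2) by auto
  qed
  have step: "F (Suc i) x \<le> F i x" if "i < k" for i
    using that
  proof (induction i)
    case 0
    then show ?case using arg[of 0] G_le_1 by simp
  next
    case (Suc i)
    then show ?case using arg[of i] arg[of "Suc i"] by (auto intro!: G_mono)
  qed
  show ?thesis
    using assms(3,4)
  proof (induction j rule: dec_induct)
    case (step n)
    then show ?case using \<open>\<And>i. i < k \<Longrightarrow> F (Suc i) x \<le> F i x\<close>[of n] by simp
  qed simp
qed

lemma F_antimono:
  assumes "k \<ge> 1" "i \<le> k" "0 \<le> x" "x \<le> y" "y \<le> c (k - 1)"
  shows "F i y \<le> F i x"
proof (cases i)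
  case (Suc j)
  have "c (k - 1) \<le> c j" using assms Suc by (intro c_decreasing) simp
  then have "y \<le> c j" using assms by simp
  then show ?thesis
    using F_Suc_strict_antimono[OF well_behaved, of x y j] assms Suc
    by (cases "x = y") (auto simp del: F_fun.simps)
qed simp

lemma F_continuous:
  assumes "k \<ge> 1" "i \<le> k"
  shows "continuous_on {0..c (k - 1)} (F i)"
proof (cases i)
  case (Suc j)
  have "c (k - 1) \<le> c j" using assms Suc by (intro c_decreasing) simp
  then have "{0..c (k - 1)} \<subseteq> {0..c j}" by auto
  then show ?thesis
    using F_Suc_continuous[OF well_behaved, of j] Suc continuous_on_subset by metis
qed simp

lemma F_ge_leaf:
  assumes "k \<ge> 1" "x \<in> {0..c (k - 1)}"
  shows "leaf_prob \<le> F k x"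
  using assms F_Suc_arg[OF well_behaved, of x "k - 1"] G_ge_leaf
  by (cases k) auto

text \<open>
  \<open>gamma_F k l j x\<close> is $\gamma_{l+1}(F_j(x), F_{k-l}(x), F_{k-l+1}(x), \ldots, F_k(x))$.  Unfolding
  $\gamma_k(F_0(x), \ldots, F_k(x))$ produces only argument lists of this shape, and the two
  parameters allow an induction on \<open>l\<close>.
\<close>
primrec gamma_F :: "nat \<Rightarrow> nat \<Rightarrow> nat \<Rightarrow> real \<Rightarrow> real" where
  "gamma_F k 0 j x = F j x - F k x"
| "gamma_F k (Suc l) j x =
     G (leaf_prob + gamma_F k l j x) - G (leaf_prob + gamma_F k l (k - Suc l) x)"

lemma gamma_fun_eq_gamma_F:
  "l < k \<Longrightarrow> gamma_fun \<xi> (F j x # map (\<lambda>i. F i x) [k - l..<Suc k]) = gamma_F k l j x"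
proof (induction l arbitrary: j)
  case (Suc l)
  have *: "[k - Suc l..<Suc k] = (k - Suc l) # [k - l..<Suc k]"
    using Suc.prems by (subst upt_conv_Cons) (auto simp: Suc_diff_Suc simp del: upt_Suc)
  have **: "[k - l..<Suc k] = (k - l) # [Suc (k - l)..<Suc k]"
    by (rule upt_conv_Cons) simp
  have "gamma_fun \<xi> (F j x # map (\<lambda>i. F i x) [k - Suc l..<Suc k]) =
      G (leaf_prob + gamma_fun \<xi> (F j x # map (\<lambda>i. F i x) [k - l..<Suc k])) -
      G (leaf_prob + gamma_fun \<xi> (F (k - Suc l) x # map (\<lambda>i. F i x) [k - l..<Suc k]))"
    unfolding * ** list.map gamma_fun.simps ..
  then show ?case using Suc by simp
qed simp

lemma J_fun_eq: "k \<ge> 1 \<Longrightarrow> J_fun \<xi> k x = G (leaf_prob + gamma_F k (k - 1) 0 x) - leaf_prob"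
  using gamma_fun_eq_gamma_F[of "k - 1" k 0 x]
  by (simp add: J_fun_def upt_conv_Cons[of 0 "Suc k"] del: upt_Suc)

text \<open>
  Besides keeping the arguments of \<open>G\<close> inside \<open>{0..1}\<close>, this records that \<open>gamma_F k l j\<close> is antitone in \<open>j\<close>, so
  that the increments of \<open>G\<close> compared in the monotonicity proof are taken over genuine intervals.
\<close>
lemma gamma_F_bounds:
  assumes k: "k \<ge> 1" and x: "x \<in> {0..c (k - 1)}"
  shows "l \<le> k \<Longrightarrow> j \<le> j' \<Longrightarrow> j' \<le> k - l \<Longrightarrow>
           0 \<le> gamma_F k l j' x \<and> gamma_F k l j' x \<le> gamma_F k l j x \<and>
           gamma_F k l j x \<le> 1 - leaf_prob"
proof (induction l arbitrary: j j')
  case 0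
  then show ?case
    using F_antimono_index[OF k x, of j j'] F_antimono_index[OF k x, of j' k]
      F_antimono_index[OF k x, of 0 j] F_ge_leaf[OF k x] by simp
next
  case (Suc l)
  let ?g = "gamma_F k l" and ?i = "k - Suc l"
  have arg: "0 \<le> leaf_prob + ?g i x" "leaf_prob + ?g i x \<le> 1" if "i \<le> k - l" for i
    using Suc.IH[of i i] Suc.prems that leaf_pos by auto
  have mono: "G (leaf_prob + ?g i' x) \<le> G (leaf_prob + ?g i x)" if "i \<le> i'" "i' \<le> ?i" for i i'
    using Suc.IH[of i i'] Suc.prems that arg[of i] arg[of i'] by (intro G_mono) auto
  have "G (leaf_prob + ?g ?i x) \<ge> leaf_prob" "G (leaf_prob + ?g j x) \<le> 1"
    using arg[of ?i] arg[of j] Suc.prems by (auto intro!: G_ge_leaf G_le_1)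
  then show ?case using mono[of j j'] mono[of j' ?i] Suc.prems by simp
qed

lemma gamma_F_arg:
  assumes "k \<ge> 1" "x \<in> {0..c (k - 1)}" "l \<le> k" "j \<le> k - l"
  shows "0 \<le> leaf_prob + gamma_F k l j x" "leaf_prob + gamma_F k l j x \<le> 1"
  using gamma_F_bounds[OF assms(1-3) order.refl assms(4)] leaf_pos by auto

text \<open>
  The first conjunct is the goal; the second makes the induction work.  For \<open>j > 0\<close> the function
  \<open>gamma_F k l j\<close> need not be monotone, but its distance below \<open>gamma_F k l 0\<close> is.
  When the larger argument of \<open>G\<close> and its distance to the smaller one both increase, convexity makes
  the difference of the values of \<open>G\<close> increase; and in a difference of two values of \<open>gamma_F k (Suc l)\<close>
  the common subtrahend cancels.
\<close>
lemma gamma_F_mono: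
  assumes k: "k \<ge> 1" and xy: "0 \<le> x" "x \<le> y" "y \<le> c (k - 1)"
  shows "l \<le> k \<Longrightarrow> j \<le> k - l \<Longrightarrow>
           gamma_F k l 0 x \<le> gamma_F k l 0 y \<and>
           gamma_F k l 0 x - gamma_F k l j x \<le> gamma_F k l 0 y - gamma_F k l j y"
proof (induction l arbitrary: j)
  case 0
  then show ?case using F_antimono[OF k _ xy] by simp
next
  case (Suc l)
  let ?g = "\<lambda>i x. leaf_prob + gamma_F k l i x"
  have in_dom: "x \<in> {0..c (k - 1)}" "y \<in> {0..c (k - 1)}" using xy by auto
  have "G (?g 0 x) - G (?g i x) \<le> G (?g 0 y) - G (?g i y)" if "i \<le> k - l" for i
    using Suc.IH[of i] gamma_F_bounds[OF k in_dom(1), of l 0 i]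
      gamma_F_arg[OF k in_dom(1), of l i] gamma_F_arg[OF k in_dom(2), of l i]
      gamma_F_arg[OF k in_dom(2), of l 0] Suc.prems that
    by (intro G_diff_mono) auto
  from this[of j] this[of "k - Suc l"] show ?case using Suc.prems by simp
qed

lemma gamma_F_continuous:
  assumes k: "k \<ge> 1"
  shows "l \<le> k \<Longrightarrow> j \<le> k - l \<Longrightarrow> continuous_on {0..c (k - 1)} (gamma_F k l j)"
proof (induction l arbitrary: j)
  case 0
  then show ?case
    using F_continuous[OF k, of j] F_continuous[OF k, of k] by (simp add: continuous_on_diff)
next
  case (Suc l)
  have "continuous_on {0..c (k - 1)} (\<lambda>x. G (leaf_prob + gamma_F k l i x))" if "i \<le> k - l" for i
    using Suc that gamma_F_arg[OF k, of _ l i]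
    by (intro continuous_on_G_comp continuous_on_add continuous_on_const) auto
  then show ?case using Suc.prems by (simp, intro continuous_on_diff) auto
qed

text \<open>
  The vertical distance between the curves whose intersection is $\hat c_k$.  In the misere game its
  value at the loss probability is the draw probability.
\<close>
definition gap :: "nat \<Rightarrow> real \<Rightarrow> real" where
  "gap k x = F k x - (J_fun \<xi> k x + leaf_prob)"

lemma gap_eq: "k \<ge> 1 \<Longrightarrow> gap k x = F k x - G (leaf_prob + gamma_F k (k - 1) 0 x)"
  by (simp add: gap_def J_fun_eq)

lemma gap_strict_antimono:
  assumes k: "k \<ge> 1" and "0 \<le> x" "x < y" "y \<le> c (k - 1)"
  shows "gap k y < gap k x"
proof -
  have dom: "x \<in> {0..c (k - 1)}" "y \<in> {0..c (k - 1)}" using assms by auto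
  have "F k y < F k x"
    using F_Suc_strict_antimono[OF well_behaved, of x y "k - 1"] assms by simp
  moreover have "G (leaf_prob + gamma_F k (k - 1) 0 x) \<le> G (leaf_prob + gamma_F k (k - 1) 0 y)"
    using gamma_F_mono[OF k, of x y "k - 1" 0] gamma_F_arg[OF k dom(1), of "k - 1" 0]
      gamma_F_arg[OF k dom(2), of "k - 1" 0] assms by (intro G_mono) auto
  ultimately show ?thesis by (simp add: gap_eq[OF k])
qed

lemma gap_continuous:
  assumes k: "k \<ge> 1"
  shows "continuous_on {0..c (k - 1)} (gap k)"
proof -
  have "continuous_on {0..c (k - 1)} (\<lambda>x. F k x - G (leaf_prob + gamma_F k (k - 1) 0 x))"
    using gamma_F_arg[OF k, of _ "k - 1" 0] gamma_F_continuous[OF k, of "k - 1" 0]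
      F_continuous[OF k, of k]
    by (intro continuous_on_diff continuous_on_G_comp continuous_on_add continuous_on_const) auto
  then show ?thesis by (simp add: gap_eq[OF k, abs_def])
qed

lemma gamma_F_at_0: "gamma_F k l j 0 = 0"
  by (induction l arbitrary: j) auto

lemma gap_at_0: "k \<ge> 1 \<Longrightarrow> 0 < gap k 0"
  using G_strict_mono[of leaf_prob 1] leaf_pos leaf_less_1 by (simp add: gap_eq gamma_F_at_0)

text \<open>
  At \<open>c (k - 1)\<close> the argument of the outer \<open>G\<close> in \<open>F k\<close> vanishes, so that \<open>F k\<close> takes the value \<open>leaf_prob = G 0\<close>,
  while the argument of the outer \<open>G\<close> in the other curve is at least \<open>leaf_prob\<close>, hence positive.
\<close>
lemma gap_at_c:
  assumes k: "k \<ge> 1"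
  shows "gap k (c (k - 1)) < 0"
proof -
  have c: "c (k - 1) \<in> {0..c (k - 1)}" using c_ge_leaf[of "k - 1"] leaf_pos by auto
  have "0 < leaf_prob + gamma_F k (k - 1) 0 (c (k - 1))"
    using gamma_F_bounds[OF k c, of "k - 1" 0 0] leaf_pos by simp
  then have "G 0 < G (leaf_prob + gamma_F k (k - 1) 0 (c (k - 1)))"
    using gamma_F_arg[OF k c, of "k - 1" 0] by (intro G_strict_mono) auto
  then show ?thesis
    using F_Suc_at_c[OF well_behaved, of "k - 1"] k by (simp add: gap_eq)
qed

lemma meets_at_iff: "meets_at \<xi> k x \<longleftrightarrow> x \<in> {0<..<c (k - 1)} \<and> gap k x = 0"
  by (auto simp: meets_at_def gap_def)

lemma meets_at_unique:
  assumes k: "k \<ge> 1"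
  shows "\<exists>!x. meets_at \<xi> k x"
proof -
  have "0 \<le> c (k - 1)" using c_ge_leaf[of "k - 1"] leaf_pos by simp
  then obtain x where x: "0 \<le> x" "x \<le> c (k - 1)" "gap k x = 0"
    using IVT2'[of "gap k" "c (k - 1)" 0 0] gap_at_0[OF k] gap_at_c[OF k] gap_continuous[OF k]
    by auto
  then have "meets_at \<xi> k x"
    using gap_at_0[OF k] gap_at_c[OF k] by (auto simp: meets_at_iff less_le)
  moreover have "y = x" if "meets_at \<xi> k y" for y
    using that x gap_strict_antimono[OF k, of x y] gap_strict_antimono[OF k, of y x]
    by (cases x y rule: linorder_cases) (auto simp: meets_at_iff)
  ultimately show ?thesis by blast
qed

lemma gap_sign_iff:
  assumes k: "k \<ge> 1" and x: "x \<in> {0..c (k - 1)}"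
  shows "0 \<le> gap k x \<longleftrightarrow> x \<le> c_hat \<xi> k" "0 < gap k x \<longleftrightarrow> x < c_hat \<xi> k"
proof -
  have "meets_at \<xi> k (c_hat \<xi> k)"
    unfolding c_hat_def by (rule theI'[OF meets_at_unique[OF k]])
  then have *: "c_hat \<xi> k \<in> {0<..<c (k - 1)}" "gap k (c_hat \<xi> k) = 0"
    by (auto simp: meets_at_iff)
  then show "0 \<le> gap k x \<longleftrightarrow> x \<le> c_hat \<xi> k" "0 < gap k x \<longleftrightarrow> x < c_hat \<xi> k"
    using x gap_strict_antimono[OF k, of x "c_hat \<xi> k"] gap_strict_antimono[OF k, of "c_hat \<xi> k" x]
    by (cases x "c_hat \<xi> k" rule: linorder_cases; auto)+
qed

end


section \<open>Jump moves in a tree and in its subtrees\<close>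

definition subtree :: "nat \<Rightarrow> (nat list \<Rightarrow> nat) \<Rightarrow> nat list \<Rightarrow> nat" where
  "subtree j \<omega> u = \<omega> (j # u)"

lemma GW_tree_iff: "v \<in> GW_tree \<omega> \<longleftrightarrow> (\<forall>i<length v. v ! i < \<omega> (take i v))"
proof (induction v rule: rev_induct)
  case Nil
  then show ?case by (simp add: GW_tree.root)
next
  case (snoc j u)
  have "u @ [j] \<in> GW_tree \<omega> \<longleftrightarrow> u \<in> GW_tree \<omega> \<and> j < \<omega> u"
    by (auto intro: GW_tree.child elim: GW_tree.cases)
  also have "\<dots> \<longleftrightarrow> (\<forall>i<length (u @ [j]). (u @ [j]) ! i < \<omega> (take i (u @ [j])))"
    using snoc.IH by (auto simp: nth_append less_Suc_eq)
  finally show ?case .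
qed

lemma Cons_in_GW_tree: "j # u \<in> GW_tree \<omega> \<longleftrightarrow> j < \<omega> [] \<and> u \<in> GW_tree (subtree j \<omega>)"
  by (simp add: GW_tree_iff All_less_Suc2 subtree_def)

lemma jump_moves_subtree:
  assumes "j < \<omega> []"
  shows "jump_moves k \<omega> (j # u) = (#) j ` jump_moves k (subtree j \<omega>) u"
  using assms unfolding jump_moves_def by (auto simp: Cons_in_GW_tree)

lemma jump_moves_0: "jump_moves 0 \<omega> u = {}"
  by (auto simp: jump_moves_def)

text \<open>
  A nontrivial descent from the root consists of a step to a child and a possibly trivial descent
  within the subtree at that child.
\<close>
lemma jump_moves_Suc_root:
  "jump_moves (Suc i) \<omega> [] =
     (\<Union>j<\<omega> []. (#) j ` insert [] (jump_moves i (subtree j \<omega>) []))"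
proof (intro set_eqI)
  fix v
  show "v \<in> jump_moves (Suc i) \<omega> [] \<longleftrightarrow>
      v \<in> (\<Union>j<\<omega> []. (#) j ` insert [] (jump_moves i (subtree j \<omega>) []))"
    by (cases v) (auto simp: jump_moves_def Cons_in_GW_tree GW_tree.root)
qed

lemma jump_moves_root_empty_iff: "k \<ge> 1 \<Longrightarrow> jump_moves k \<omega> [] = {} \<longleftrightarrow> \<omega> [] = 0"
  by (cases k) (auto simp: jump_moves_Suc_root)

lemma jump_moves_mono: "i \<le> i' \<Longrightarrow> jump_moves i \<omega> u \<subseteq> jump_moves i' \<omega> u"
  by (auto simp: jump_moves_def)

text \<open>
  Positions outside the tree have no moves at all, so finiteness holds at every list.
\<close>
lemma finite_jump_moves: "finite (jump_moves k \<omega> u)"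
proof -
  have root: "finite (jump_moves k \<omega> [])" for k and \<omega>
    by (induction k arbitrary: \<omega>) (simp_all add: jump_moves_0 jump_moves_Suc_root)
  show ?thesis
  proof (induction u arbitrary: \<omega>)
    case (Cons j u)
    show ?case
    proof (cases "j < \<omega> []")
      case False
      then have "jump_moves k \<omega> (j # u) = {}" by (auto simp: jump_moves_def Cons_in_GW_tree)
      then show ?thesis by simp
    qed (simp add: jump_moves_subtree Cons)
  qed (rule root)
qed

lemma loses_in_subtree:
  assumes "j < \<omega> []"
  shows "loses_in g (jump_moves k \<omega>) n (j # u) \<longleftrightarrow> loses_in g (jump_moves k (subtree j \<omega>)) n u"
  by (induction n arbitrary: u) (simp_all add: jump_moves_subtree[of j \<omega> k, OF assms])

lemma lost_subtree:
  "j < \<omega> [] \<Longrightarrow> lost g (jump_moves k \<omega>) (j # u) \<longleftrightarrow> lost g (jump_moves k (subtree j \<omega>)) u"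
  by (simp add: lost_def loses_in_subtree)

lemma won_subtree:
  "j < \<omega> [] \<Longrightarrow> won g (jump_moves k \<omega>) (j # u) \<longleftrightarrow> won g (jump_moves k (subtree j \<omega>)) u"
  by (simp add: won_def jump_moves_subtree lost_subtree)


section \<open>Independence of the subtrees at the children of the root\<close>

context offspring
begin

abbreviation GW :: "(nat list \<Rightarrow> nat) measure" where "GW \<equiv> GW_measure \<xi>"

sublocale prob_space GW
  unfolding GW_measure_def by (intro prob_space_PiM prob_space_measure_pmf)

lemma space_GW: "space GW = UNIV"
  by (simp add: GW_measure_def space_PiM)

lemma measurable_offspring [measurable]: "(\<lambda>\<omega>. \<omega> u) \<in> measurable GW (count_space UNIV)"
  unfolding GW_measure_def
  using measurable_component_singleton[of u UNIV "\<lambda>_. measure_pmf \<xi>"] by (simp add: measurable_pmf_measure2)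

lemma measurable_subtree [measurable]: "subtree j \<in> measurable GW GW"
proof -
  have "(\<lambda>\<omega>. \<lambda>u\<in>UNIV. \<omega> (j # u)) \<in> measurable (Pi\<^sub>M UNIV (\<lambda>_. measure_pmf \<xi>)) (Pi\<^sub>M UNIV (\<lambda>_. measure_pmf \<xi>))"
    by (intro measurable_restrict measurable_component_singleton) simp
  then show ?thesis by (simp add: GW_measure_def subtree_def[abs_def] restrict_UNIV)
qed

lemma distr_subtree: "distr GW GW (subtree j) = GW"
  using distr_PiM_reindex[of UNIV "\<lambda>_. measure_pmf \<xi>" "(#) j" UNIV]
  by (simp add: GW_measure_def subtree_def[abs_def] restrict_UNIV prob_space_measure_pmf)

lemma prob_subtree:
  assumes [measurable]: "Measurable.pred GW A"
  shows "\<P>(\<omega> in GW. A (subtree j \<omega>)) = \<P>(\<omega> in GW. A \<omega>)"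
proof -
  have A: "{\<omega> \<in> space GW. A \<omega>} \<in> events" by measurable
  have "\<P>(\<omega> in GW. A \<omega>) = measure (distr GW GW (subtree j)) {\<omega> \<in> space GW. A \<omega>}"
    by (simp only: distr_subtree)
  also have "\<dots> = \<P>(\<omega> in GW. A (subtree j \<omega>))"
    by (simp only: measure_distr[OF measurable_subtree A]) (simp add: vimage_def space_GW)
  finally show ?thesis by simp
qed

lemma prob_offspring: "\<P>(\<omega> in GW. \<omega> u = m) = pmf \<xi> m"
proof -
  have "distr GW (measure_pmf \<xi>) (\<lambda>\<omega>. \<omega> u) = measure_pmf \<xi>"
    using distr_PiM_component[of UNIV "\<lambda>_. measure_pmf \<xi>" u]
    by (simp add: GW_measure_def prob_space_measure_pmf)
  then have "pmf \<xi> m = measure (distr GW (measure_pmf \<xi>) (\<lambda>\<omega>. \<omega> u)) {m}"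
    by (simp add: pmf.rep_eq)
  also have "\<dots> = \<P>(\<omega> in GW. \<omega> u = m)"
    by (subst measure_distr)
       (auto intro!: arg_cong[where f="measure GW"] simp: measurable_pmf_measure2 space_GW)
  finally show ?thesis by simp
qed

lemma indep_coordinates: "indep_vars (\<lambda>_. measure_pmf \<xi>) (\<lambda>u \<omega>. \<omega> u) UNIV"
proof -
  have "distr GW (measure_pmf \<xi>) (\<lambda>\<omega>. \<omega> u) = measure_pmf \<xi>" for u
    using distr_PiM_component[of UNIV "\<lambda>_. measure_pmf \<xi>" u]
    by (simp add: GW_measure_def prob_space_measure_pmf)
  then have "distr GW (Pi\<^sub>M UNIV (\<lambda>_. measure_pmf \<xi>)) (\<lambda>\<omega>. \<lambda>u\<in>UNIV. \<omega> u) =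
      Pi\<^sub>M UNIV (\<lambda>u. distr GW (measure_pmf \<xi>) (\<lambda>\<omega>. \<omega> u))"
    by (simp add: GW_measure_def restrict_UNIV distr_id2)
  then show ?thesis
    by (subst indep_vars_iff_distr_eq_PiM)
       (auto simp: measurable_pmf_measure2)
qed

text \<open>
  The offspring number of the root and the subtrees at its potential children depend on disjoint
  blocks of the independent coordinates: block \<open>0\<close> is the root, block \<open>Suc j\<close> the subtree at child \<open>j\<close>.
\<close>
lemma prob_root_and_subtrees:
  assumes A [measurable]: "Measurable.pred GW A"
  shows "\<P>(\<omega> in GW. \<omega> [] = m \<and> (\<forall>j<m. A (subtree j \<omega>))) = pmf \<xi> m * \<P>(\<omega> in GW. A \<omega>) ^ m"
proof -
  define K where "K i = (case i of 0 \<Rightarrow> {[]} | Suc j \<Rightarrow> range ((#) j))" for i :: nat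
  define X where "X i \<omega> = restrict (\<lambda>u. \<omega> u) (K i)" for i and \<omega> :: "nat list \<Rightarrow> nat"
  define B where "B i = (case i of 0 \<Rightarrow> {f \<in> space (Pi\<^sub>M (K i) (\<lambda>_. measure_pmf \<xi>)). f [] = m}
      | Suc j \<Rightarrow> {f \<in> space (Pi\<^sub>M (K i) (\<lambda>_. measure_pmf \<xi>)). A (\<lambda>u. f (j # u))})" for i
  have "disjoint_family_on K UNIV"
    by (auto simp: disjoint_family_on_def K_def split: nat.splits)
  then have indep: "indep_vars (\<lambda>i. Pi\<^sub>M (K i) (\<lambda>_. measure_pmf \<xi>)) X UNIV"
    unfolding X_def using indep_vars_restrict[OF indep_coordinates] by simp
  have B: "B i \<in> sets (Pi\<^sub>M (K i) (\<lambda>_. measure_pmf \<xi>))" for i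
  proof (cases i)
    case 0
    have "(\<lambda>f. f []) \<in> measurable (Pi\<^sub>M (K 0) (\<lambda>_. measure_pmf \<xi>)) (count_space UNIV)"
      using measurable_component_singleton[of "[]" "K 0" "\<lambda>_. measure_pmf \<xi>"]
      by (simp add: K_def measurable_pmf_measure2)
    then show ?thesis unfolding B_def 0 by simp
  next
    case (Suc j)
    have "(\<lambda>f. \<lambda>u\<in>UNIV. f (j # u)) \<in> measurable (Pi\<^sub>M (K (Suc j)) (\<lambda>_. measure_pmf \<xi>)) GW"
      unfolding GW_measure_def
      by (intro measurable_restrict measurable_component_singleton) (simp add: K_def)
    then have "(\<lambda>f u. f (j # u)) \<in> measurable (Pi\<^sub>M (K (Suc j)) (\<lambda>_. measure_pmf \<xi>)) GW"
      by (simp add: restrict_UNIV)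
    then show ?thesis unfolding B_def Suc by simp
  qed
  have X0: "X 0 -` B 0 \<inter> space GW = {\<omega> \<in> space GW. \<omega> [] = m}"
    by (auto simp: X_def B_def K_def space_PiM space_GW)
  have XS: "X (Suc j) -` B (Suc j) \<inter> space GW = {\<omega> \<in> space GW. A (subtree j \<omega>)}" for j
    by (auto simp: X_def B_def K_def space_PiM space_GW subtree_def[abs_def])
  have *: "{..m} = insert 0 (Suc ` {..<m})"
    by (auto simp: image_iff) (metis Suc_pred bot_nat_0.not_eq_extremum lessThan_iff Suc_le_lessD)
  have "{\<omega> \<in> space GW. \<omega> [] = m \<and> (\<forall>j<m. A (subtree j \<omega>))} = (\<Inter>i\<in>{..m}. X i -` B i \<inter> space GW)"
  proof -
    have "(\<Inter>i\<in>{..m}. X i -` B i \<inter> space GW) =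
        (X 0 -` B 0 \<inter> space GW) \<inter> (\<Inter>j\<in>{..<m}. X (Suc j) -` B (Suc j) \<inter> space GW)"
      unfolding * by blast
    then show ?thesis unfolding X0 XS by auto
  qed
  also have "prob \<dots> = (\<Prod>i\<in>{..m}. prob (X i -` B i \<inter> space GW))"
    using indep B by (intro indep_varsD) auto
  also have "\<dots> = prob (X 0 -` B 0 \<inter> space GW) * (\<Prod>j<m. prob (X (Suc j) -` B (Suc j) \<inter> space GW))"
    unfolding * by (subst prod.insert) (auto simp: prod.reindex)
  also have "\<dots> = pmf \<xi> m * \<P>(\<omega> in GW. A \<omega>) ^ m"
    unfolding X0 XS prob_offspring prob_subtree[OF A] by simp
  finally show ?thesis .
qed

text \<open>
  Splitting by the offspring number \<open>m\<close> of the root yields the power series of \<open>G\<close>: the event requires \<open>m\<close>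
  independent copies of \<open>A\<close>.
\<close>
lemma prob_all_children:
  assumes [measurable]: "Measurable.pred GW A"
  shows "\<P>(\<omega> in GW. \<forall>j<\<omega> []. A (subtree j \<omega>)) = G \<P>(\<omega> in GW. A \<omega>)"
proof -
  let ?E = "\<lambda>m. {\<omega> \<in> space GW. \<omega> [] = m \<and> (\<forall>j<m. A (subtree j \<omega>))}"
  have "(\<lambda>m. prob (?E m)) sums prob (\<Union>m. ?E m)"
    by (rule finite_measure_UNION) (auto simp: disjoint_family_on_def)
  moreover have "(\<Union>m. ?E m) = {\<omega> \<in> space GW. \<forall>j<\<omega> []. A (subtree j \<omega>)}"
    by auto
  ultimately show ?thesis
    using prob_root_and_subtrees[OF assms] by (simp add: G_fun_def sums_iff)
qed

lemma pred_jump_move [measurable]: "Measurable.pred GW (\<lambda>\<omega>. v \<in> jump_moves k \<omega> u)"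
  unfolding jump_moves_def GW_tree_iff by simp

lemma pred_no_move [measurable]: "Measurable.pred GW (\<lambda>\<omega>. jump_moves k \<omega> u = {})"
proof -
  have "Measurable.pred GW (\<lambda>\<omega>. \<forall>v. v \<notin> jump_moves k \<omega> u)" by measurable
  then show ?thesis by (simp only: all_not_in_conv)
qed

lemma pred_loses_in [measurable]: "Measurable.pred GW (\<lambda>\<omega>. loses_in g (jump_moves k \<omega>) n v)"
proof (induction n arbitrary: v)
  case (Suc n)
  note [measurable] = Suc
  have "Measurable.pred GW (\<lambda>\<omega>. (g = Misere \<longrightarrow> jump_moves k \<omega> v \<noteq> {}) \<and>
      (\<forall>u. u \<in> jump_moves k \<omega> v \<longrightarrow> g = Misere \<and> jump_moves k \<omega> u = {} \<or>
        (\<exists>w. w \<in> jump_moves k \<omega> u \<and> loses_in g (jump_moves k \<omega>) n w)))"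
    by measurable
  then show ?case by (simp add: Ball_def Bex_def)
qed simp

lemma pred_lost [measurable]: "Measurable.pred GW (\<lambda>\<omega>. lost g (jump_moves k \<omega>) v)"
  unfolding lost_def by measurable

lemma pred_won [measurable]: "Measurable.pred GW (\<lambda>\<omega>. won g (jump_moves k \<omega>) v)"
proof -
  have "Measurable.pred GW (\<lambda>\<omega>. g = Misere \<and> jump_moves k \<omega> v = {} \<or>
      (\<exists>u. u \<in> jump_moves k \<omega> v \<and> lost g (jump_moves k \<omega>) u))"
    by measurable
  then show ?thesis by (simp add: won_def Bex_def)
qed

end


section \<open>Probabilities of the outcomes of the jump games\<close>

locale jump_game = offspring +
  fixes g :: convention and k :: nat
  assumes k_ge_1: "k \<ge> 1"
begin

definition root_lost :: "(nat list \<Rightarrow> nat) \<Rightarrow> bool" where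
  "root_lost \<omega> \<longleftrightarrow> lost g (jump_moves k \<omega>) []"

definition root_won :: "(nat list \<Rightarrow> nat) \<Rightarrow> bool" where
  "root_won \<omega> \<longleftrightarrow> won g (jump_moves k \<omega>) []"

definition none_lost :: "nat \<Rightarrow> (nat list \<Rightarrow> nat) \<Rightarrow> bool" where
  "none_lost i \<omega> \<longleftrightarrow> (\<forall>v\<in>jump_moves i \<omega> []. \<not> lost g (jump_moves k \<omega>) v)"

definition all_won :: "nat \<Rightarrow> (nat list \<Rightarrow> nat) \<Rightarrow> bool" where
  "all_won i \<omega> \<longleftrightarrow> (\<forall>v\<in>jump_moves i \<omega> []. won g (jump_moves k \<omega>) v)"

lemma pred_root [measurable]:
  "Measurable.pred GW root_lost" "Measurable.pred GW root_won"
  unfolding root_lost_def root_won_def by measurable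

lemma pred_none_lost [measurable]: "Measurable.pred GW (none_lost i)"
proof -
  have "Measurable.pred GW (\<lambda>\<omega>. \<forall>v. v \<in> jump_moves i \<omega> [] \<longrightarrow> \<not> lost g (jump_moves k \<omega>) v)"
    by measurable
  then show ?thesis by (simp add: none_lost_def[abs_def] Ball_def)
qed

lemma pred_all_won [measurable]: "Measurable.pred GW (all_won i)"
proof -
  have "Measurable.pred GW (\<lambda>\<omega>. \<forall>v. v \<in> jump_moves i \<omega> [] \<longrightarrow> won g (jump_moves k \<omega>) v)"
    by measurable
  then show ?thesis by (simp add: all_won_def[abs_def] Ball_def)
qed

lemma none_lost_0: "none_lost 0 \<omega>" and all_won_0: "all_won 0 \<omega>"
  by (simp_all add: none_lost_def all_won_def jump_moves_0)

lemma none_lost_Suc: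
  "none_lost (Suc i) \<omega> \<longleftrightarrow> (\<forall>j<\<omega> []. \<not> root_lost (subtree j \<omega>) \<and> none_lost i (subtree j \<omega>))"
  by (auto simp: none_lost_def root_lost_def jump_moves_Suc_root lost_subtree)

lemma all_won_Suc:
  "all_won (Suc i) \<omega> \<longleftrightarrow> (\<forall>j<\<omega> []. root_won (subtree j \<omega>) \<and> all_won i (subtree j \<omega>))"
  by (auto simp: all_won_def root_won_def jump_moves_Suc_root won_subtree)

lemma root_lost_iff: "root_lost \<omega> \<longleftrightarrow> (g = Misere \<longrightarrow> \<omega> [] \<noteq> 0) \<and> all_won k \<omega>"
  unfolding root_lost_def lost_iff[OF finite_jump_moves] all_won_def
  by (simp add: jump_moves_root_empty_iff[OF k_ge_1])

lemma root_won_iff: "root_won \<omega> \<longleftrightarrow> g = Misere \<and> \<omega> [] = 0 \<or> \<not> none_lost k \<omega>"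
  unfolding root_won_def won_def none_lost_def
  by (simp add: jump_moves_root_empty_iff[OF k_ge_1])

lemma root_lost_not_won: "root_lost \<omega> \<Longrightarrow> \<not> root_won \<omega>"
  unfolding root_lost_def root_won_def by (intro lost_imp_not_won finite_jump_moves)

lemma none_lost_mono: "i \<le> i' \<Longrightarrow> none_lost i' \<omega> \<Longrightarrow> none_lost i \<omega>"
  unfolding none_lost_def using jump_moves_mono by blast

lemma all_won_imp_none_lost: "all_won i \<omega> \<Longrightarrow> none_lost i \<omega>"
  unfolding all_won_def none_lost_def using lost_imp_not_won[of "jump_moves k \<omega>" g, OF finite_jump_moves] by blast

text \<open>
  All moves from a lost root lead to won vertices, which are not lost.  This is what allows the
  subtraction of probabilities in the recursion for \<open>none_lost\<close>.
\<close>
lemma root_lost_imp_none_lost: "i \<le> k \<Longrightarrow> root_lost \<omega> \<Longrightarrow> none_lost i \<omega>"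
  using root_lost_iff all_won_imp_none_lost none_lost_mono by blast

lemma leaf_imp_none_lost: "\<omega> [] = 0 \<Longrightarrow> none_lost i \<omega>"
  by (cases i) (simp_all add: none_lost_0 none_lost_Suc)

lemma leaf_imp_all_won: "\<omega> [] = 0 \<Longrightarrow> all_won i \<omega>"
  by (cases i) (simp_all add: all_won_0 all_won_Suc)

abbreviation loss :: real where "loss \<equiv> loss_prob g \<xi> k"

lemma loss_eq: "loss = \<P>(\<omega> in GW. root_lost \<omega>)"
  unfolding loss_prob_def root_lost_def P1_loses_iff[OF finite_jump_moves] ..

lemma draw_eq: "draw_prob g \<xi> k = \<P>(\<omega> in GW. \<not> root_lost \<omega> \<and> \<not> root_won \<omega>)"
  unfolding draw_prob_def root_lost_def root_won_def is_draw_iff[OF finite_jump_moves] ..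

lemma prob_diff:
  assumes [measurable]: "Measurable.pred GW A" "Measurable.pred GW B"
    and "\<And>\<omega>. B \<omega> \<Longrightarrow> A \<omega>"
  shows "\<P>(\<omega> in GW. A \<omega> \<and> \<not> B \<omega>) = \<P>(\<omega> in GW. A \<omega>) - \<P>(\<omega> in GW. B \<omega>)"
proof -
  have "{\<omega> \<in> space GW. A \<omega> \<and> \<not> B \<omega>} = {\<omega> \<in> space GW. A \<omega>} - {\<omega> \<in> space GW. B \<omega>}" by auto
  then show ?thesis using assms(3) by (simp only:) (intro finite_measure_Diff; auto)
qed

lemma pred_leaf [measurable]: "Measurable.pred GW (\<lambda>\<omega>. \<omega> [] = 0)"
  by measurable

lemma prob_leaf: "\<P>(\<omega> in GW. \<omega> [] = 0) = leaf_prob"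
  by (rule prob_offspring)

text \<open>
  The recursion defining \<open>F_fun\<close> is that of the events \<open>none_lost\<close>: with a lost root excluded at each child,
  \<open>none_lost i\<close> has probability \<open>F i loss - loss\<close> there.
\<close>
lemma prob_none_lost: "i \<le> Suc k \<Longrightarrow> \<P>(\<omega> in GW. none_lost i \<omega>) = F i loss"
proof (induction i)
  case 0
  show ?case using prob_space by (simp add: none_lost_0)
next
  case (Suc i)
  have "\<P>(\<omega> in GW. none_lost (Suc i) \<omega>) = G \<P>(\<omega> in GW. none_lost i \<omega> \<and> \<not> root_lost \<omega>)"
    unfolding none_lost_Suc by (subst prob_all_children[symmetric]) (auto simp: conj_commute)
  also have "\<P>(\<omega> in GW. none_lost i \<omega> \<and> \<not> root_lost \<omega>) = F i loss - loss"
    using Suc root_lost_imp_none_lost[of i] by (subst prob_diff) (auto simp: loss_eq)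
  finally show ?case by simp
qed

lemma loss_nonneg: "0 \<le> loss" and loss_le_1: "loss \<le> 1"
  by (simp_all add: loss_eq)

lemma loss_le_F: "i \<le> k \<Longrightarrow> loss \<le> F i loss"
  using root_lost_imp_none_lost[of i]
  by (subst (1) loss_eq, subst prob_none_lost[symmetric]) (auto intro!: finite_measure_mono)

lemma loss_le_c: "i \<le> k \<Longrightarrow> loss \<le> c i"
proof (induction i)
  case 0
  show ?case by (simp add: loss_le_1)
next
  case (Suc i)
  then show ?case
    using loss_le_F[of "Suc i"] F_fixed_point_iff(1)[of loss i] loss_nonneg
    by (auto simp del: F_fun.simps c_num.simps)
qed

lemma loss_in_domain: "loss \<in> {0..c (k - 1)}"
  using loss_le_c[of "k - 1"] loss_nonneg by simp

lemma prob_disjoint_Un: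
  assumes [measurable]: "Measurable.pred GW A" "Measurable.pred GW B"
    and "\<And>\<omega>. A \<omega> \<Longrightarrow> \<not> B \<omega>"
  shows "\<P>(\<omega> in GW. A \<omega> \<or> B \<omega>) = \<P>(\<omega> in GW. A \<omega>) + \<P>(\<omega> in GW. B \<omega>)"
proof -
  have "{\<omega> \<in> space GW. A \<omega> \<or> B \<omega>} = {\<omega> \<in> space GW. A \<omega>} \<union> {\<omega> \<in> space GW. B \<omega>}" by auto
  then show ?thesis using assms(3) by (simp only:) (intro finite_measure_Union; auto)
qed

end


section \<open>The normal game\<close>

locale normal_jump_game = jump_game \<xi> Normal k for \<xi> k
begin

lemma draw_prob_normal: "draw_prob Normal \<xi> k = F k loss - loss"
proof -
  have "draw_prob Normal \<xi> k = \<P>(\<omega> in GW. none_lost k \<omega> \<and> \<not> root_lost \<omega>)"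
    unfolding draw_eq root_won_iff by (simp add: conj_commute)
  also have "\<dots> = F k loss - loss"
    using root_lost_imp_none_lost[of k] prob_none_lost[of k] by (subst prob_diff) (auto simp: loss_eq)
  finally show ?thesis .
qed

lemma draw_prob_normal_pos_iff: "draw_prob Normal \<xi> k > 0 \<longleftrightarrow> loss < c k"
  using F_fixed_point_iff(2)[OF loss_in_domain] k_ge_1 draw_prob_normal by simp

text \<open>
  Finite trees all of whose leaves have depth exactly \<open>h\<close>.  For \<open>h = Suc k\<close> their roots are lost without being
  leaves: every vertex at a depth from \<open>1\<close> to \<open>k\<close> can jump onto a lost leaf, but the root cannot.
\<close>
primrec leaves_at :: "nat \<Rightarrow> (nat list \<Rightarrow> nat) \<Rightarrow> bool" where
  "leaves_at 0 \<omega> \<longleftrightarrow> \<omega> [] = 0"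
| "leaves_at (Suc h) \<omega> \<longleftrightarrow> \<omega> [] \<noteq> 0 \<and> (\<forall>j<\<omega> []. leaves_at h (subtree j \<omega>))"

lemma pred_leaves_at [measurable]: "Measurable.pred GW (leaves_at h)"
proof (induction h)
  case 0
  show ?case using pred_leaf by simp
next
  case (Suc h)
  note [measurable] = Suc
  have "Measurable.pred GW (\<lambda>\<omega>. \<omega> [] \<noteq> 0 \<and> (\<forall>j<\<omega> []. leaves_at h (subtree j \<omega>)))"
    by measurable
  then show ?case by simp
qed

text \<open>
  If \<open>p > 0\<close> is the probability for \<open>h\<close>, then all children have the property for \<open>h\<close> with probability \<open>G p\<close>; as
  \<open>G p > G 0\<close>, this is not accounted for by a childless root.
\<close>
lemma prob_leaves_at_pos: "0 < \<P>(\<omega> in GW. leaves_at h \<omega>)"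
proof (induction h)
  case 0
  then show ?case using leaf_pos by (simp add: prob_leaf)
next
  case (Suc h)
  have "leaf_prob < G \<P>(\<omega> in GW. leaves_at h \<omega>)"
    using G_strict_mono[OF _ Suc] by simp
  also have "\<dots> = \<P>(\<omega> in GW. \<forall>j<\<omega> []. leaves_at h (subtree j \<omega>))"
    by (rule prob_all_children[symmetric]) measurable
  also have "\<dots> = \<P>(\<omega> in GW. \<omega> [] = 0 \<or> leaves_at (Suc h) \<omega>)"
    by (auto intro!: arg_cong[where f="measure GW"])
  also have "\<dots> = leaf_prob + \<P>(\<omega> in GW. leaves_at (Suc h) \<omega>)"
    unfolding prob_leaf[symmetric] by (rule prob_disjoint_Un[OF pred_leaf pred_leaves_at]) simp
  finally show ?case by simp
qed

lemma leaf_root_lost: "\<omega> [] = 0 \<Longrightarrow> root_lost \<omega>"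
  by (simp add: root_lost_iff leaf_imp_all_won)

lemma leaves_at_root_won: "leaves_at (Suc h) \<omega> \<Longrightarrow> Suc h \<le> k \<Longrightarrow> root_won \<omega>"
proof -
  have "leaves_at (Suc h) \<omega> \<Longrightarrow> \<not> none_lost (Suc h) \<omega>"
  proof (induction h arbitrary: \<omega>)
    case 0
    then have "0 < \<omega> []" "root_lost (subtree 0 \<omega>)" using leaf_root_lost by auto
    then show ?case unfolding none_lost_Suc by blast
  next
    case (Suc h)
    then have "0 < \<omega> []" "\<not> none_lost (Suc h) (subtree 0 \<omega>)" by (simp, fastforce)
    then show ?case unfolding none_lost_Suc[of "Suc h"] by blast
  qed
  then show "leaves_at (Suc h) \<omega> \<Longrightarrow> Suc h \<le> k \<Longrightarrow> root_won \<omega>"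
    using none_lost_mono root_won_iff by blast
qed

lemma leaves_at_all_won: "leaves_at (Suc h) \<omega> \<Longrightarrow> i \<le> h \<Longrightarrow> h \<le> k \<Longrightarrow> all_won i \<omega>"
proof (induction i arbitrary: h \<omega>)
  case 0
  show ?case by (rule all_won_0)
next
  case (Suc i)
  obtain h' where h: "h = Suc h'" using Suc.prems(2) by (cases h) auto
  have "root_won (subtree j \<omega>) \<and> all_won i (subtree j \<omega>)" if "j < \<omega> []" for j
  proof -
    have "leaves_at (Suc h') (subtree j \<omega>)" using Suc.prems(1) that unfolding h by simp
    then show ?thesis using Suc.IH[of h' "subtree j \<omega>"] leaves_at_root_won Suc.prems(2,3) h by simp
  qed
  then show ?case unfolding all_won_Suc by blast
qed

lemma leaf_less_loss: "leaf_prob < loss"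
proof -
  have "leaf_prob < leaf_prob + \<P>(\<omega> in GW. leaves_at (Suc k) \<omega>)"
    using prob_leaves_at_pos[of "Suc k"] by (simp del: leaves_at.simps)
  also have "\<dots> = \<P>(\<omega> in GW. \<omega> [] = 0 \<or> leaves_at (Suc k) \<omega>)"
    unfolding prob_leaf[symmetric] by (rule prob_disjoint_Un[OF pred_leaf pred_leaves_at, symmetric]) simp
  also have "\<dots> \<le> loss"
    unfolding loss_eq using leaf_root_lost leaves_at_all_won[of k _ k] root_lost_iff
    by (intro finite_measure_mono) (auto simp del: leaves_at.simps)
  finally show ?thesis .
qed

end


section \<open>The misere game\<close>

locale misere_jump_game = jump_game \<xi> Misere k for \<xi> k
begin

text \<open>
  For a single child the event is that it is won, \<open>all_won l\<close> and \<open>none_lost (i + l)\<close>; not being lost is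
  implied by being won.  A child is won if it is a leaf, in which case the other two hold, or else
  if \<open>none_lost k\<close> fails for it.  These two ways account for the two summands.
\<close>
lemma prob_children_won:
  assumes "i + l \<le> k"
  shows "\<P>(\<omega> in GW. all_won (Suc l) \<omega> \<and> none_lost (Suc (i + l)) \<omega>) =
    G (leaf_prob + \<P>(\<omega> in GW. all_won l \<omega> \<and> none_lost (i + l) \<omega> \<and> \<not> none_lost k \<omega>))"
proof -
  let ?A = "\<lambda>\<omega>. root_won \<omega> \<and> all_won l \<omega> \<and> none_lost (i + l) \<omega>"
  have "\<P>(\<omega> in GW. all_won (Suc l) \<omega> \<and> none_lost (Suc (i + l)) \<omega>) =
      \<P>(\<omega> in GW. \<forall>j<\<omega> []. ?A (subtree j \<omega>))"
    unfolding all_won_Suc none_lost_Suc using root_lost_not_won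
    by (auto intro!: arg_cong[where f="measure GW"])
  also have "\<dots> = G \<P>(\<omega> in GW. ?A \<omega>)"
    by (rule prob_all_children) measurable
  also have "\<P>(\<omega> in GW. ?A \<omega>) =
      \<P>(\<omega> in GW. \<omega> [] = 0 \<or> (all_won l \<omega> \<and> none_lost (i + l) \<omega> \<and> \<not> none_lost k \<omega>))"
    unfolding root_won_iff using leaf_imp_all_won leaf_imp_none_lost
    by (auto intro!: arg_cong[where f="measure GW"])
  also have "\<dots> = leaf_prob + \<P>(\<omega> in GW. all_won l \<omega> \<and> none_lost (i + l) \<omega> \<and> \<not> none_lost k \<omega>)"
    unfolding prob_leaf[symmetric]
    by (rule prob_disjoint_Un) (auto simp add: leaf_imp_none_lost)
  finally show ?thesis .
qed

text \<open>
  The probabilistic meaning of the functions $\gamma$.  In the step, both values of \<open>G\<close> are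
  probabilities of \<open>all_won (Suc l)\<close> together with \<open>none_lost m\<close>, for \<open>m = i + Suc l\<close> and for \<open>m = k\<close>; the
  second event is contained in the first, and the difference of the probabilities belongs to the
  difference of the events.
\<close>
lemma prob_gamma_F:
  "i + l \<le> k \<Longrightarrow>
     \<P>(\<omega> in GW. all_won l \<omega> \<and> none_lost (i + l) \<omega> \<and> \<not> none_lost k \<omega>) = gamma_F k l i loss"
proof (induction l arbitrary: i)
  case 0
  have "\<P>(\<omega> in GW. none_lost i \<omega> \<and> \<not> none_lost k \<omega>) = F i loss - F k loss"
    using 0 none_lost_mono[of i k] by (subst prob_diff) (auto simp: prob_none_lost)
  then show ?case by (simp add: all_won_0)
next
  case (Suc l)
  let ?B = "\<lambda>i \<omega>. all_won (Suc l) \<omega> \<and> none_lost (Suc (i + l)) \<omega>"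
  have B: "\<P>(\<omega> in GW. ?B i \<omega>) = G (leaf_prob + gamma_F k l i loss)" if "i + l \<le> k" for i
    using prob_children_won[OF that] Suc.IH[OF that] by simp
  \<comment> \<open>The subtrahend has first index \<open>k - Suc l\<close>, which is chosen to give exactly \<open>none_lost k\<close>.\<close>
  have k: "Suc (k - Suc l + l) = k" using Suc.prems by simp
  have "\<P>(\<omega> in GW. all_won (Suc l) \<omega> \<and> none_lost (i + Suc l) \<omega> \<and> \<not> none_lost k \<omega>) =
      \<P>(\<omega> in GW. ?B i \<omega> \<and> \<not> ?B (k - Suc l) \<omega>)"
    unfolding k by (auto intro!: arg_cong[where f="measure GW"])
  also have "\<dots> = \<P>(\<omega> in GW. ?B i \<omega>) - \<P>(\<omega> in GW. ?B (k - Suc l) \<omega>)"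
    using none_lost_mono[of "Suc (i + l)" k] Suc.prems unfolding k
    by (intro prob_diff) auto
  also have "\<dots> = gamma_F k (Suc l) i loss"
    using B[of i] B[of "k - Suc l"] Suc.prems by simp
  finally show ?case .
qed

lemma J_fun_loss: "J_fun \<xi> k loss = loss"
proof -
  have k: "Suc (k - 1) = k" using k_ge_1 by simp
  have "loss = \<P>(\<omega> in GW. all_won k \<omega> \<and> \<not> \<omega> [] = 0)"
    unfolding loss_eq root_lost_iff by (simp add: conj_commute)
  also have "\<dots> = \<P>(\<omega> in GW. all_won k \<omega>) - leaf_prob"
    unfolding prob_leaf[symmetric] by (rule prob_diff) (auto simp add: leaf_imp_all_won)
  also have "\<P>(\<omega> in GW. all_won k \<omega>) = \<P>(\<omega> in GW. all_won k \<omega> \<and> none_lost k \<omega>)"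
    using all_won_imp_none_lost by (auto intro!: arg_cong[where f="measure GW"])
  also have "\<dots> = G (leaf_prob + gamma_F k (k - 1) 0 loss)"
    using prob_children_won[of 0 "k - 1"] prob_gamma_F[of 0 "k - 1"] unfolding add_0 k by simp
  finally show ?thesis using J_fun_eq[OF k_ge_1] by simp
qed

text \<open>
  The root is neither won nor lost iff \<open>none_lost k\<close> holds and it is neither a leaf nor lost; leaves and
  lost roots are disjoint parts of \<open>none_lost k\<close>.
\<close>
lemma draw_prob_misere: "draw_prob Misere \<xi> k = gap k loss"
proof -
  let ?B = "\<lambda>\<omega>. \<omega> [] = 0 \<or> root_lost \<omega>"
  have "draw_prob Misere \<xi> k = \<P>(\<omega> in GW. none_lost k \<omega> \<and> \<not> ?B \<omega>)"
    unfolding draw_eq root_won_iff by (auto intro!: arg_cong[where f="measure GW"])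
  also have "\<dots> = \<P>(\<omega> in GW. none_lost k \<omega>) - \<P>(\<omega> in GW. ?B \<omega>)"
    by (rule prob_diff) (auto simp: leaf_imp_none_lost root_lost_imp_none_lost)
  also have "\<P>(\<omega> in GW. ?B \<omega>) = leaf_prob + loss"
    unfolding prob_leaf[symmetric] loss_eq
    by (rule prob_disjoint_Un) (auto simp add: root_lost_iff)
  finally show ?thesis by (simp add: prob_none_lost gap_def J_fun_loss)
qed

lemma loss_le_c_hat: "loss \<le> c_hat \<xi> k"
proof -
  have "0 \<le> draw_prob Misere \<xi> k" unfolding draw_eq by simp
  then show ?thesis
    using gap_sign_iff(1)[OF k_ge_1 loss_in_domain] draw_prob_misere by simp
qed

lemma draw_prob_misere_pos_iff: "draw_prob Misere \<xi> k > 0 \<longleftrightarrow> loss < c_hat \<xi> k"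
  using gap_sign_iff(2)[OF k_ge_1 loss_in_domain] draw_prob_misere by simp

end


section \<open>Losses and draws compared with the intersection points\<close>

theorem theorem1p3:
  fixes \<xi> :: "nat pmf" and k :: nat
  assumes "0 < pmf \<xi> 0" and "pmf \<xi> 0 < 1" and "k \<ge> 1"
  shows "(pmf \<xi> 0 < loss_prob Normal \<xi> k \<and> loss_prob Normal \<xi> k \<le> c_num \<xi> k) \<and>
         ((\<exists>!x. meets_at \<xi> k x) \<and> loss_prob Misere \<xi> k \<le> c_hat \<xi> k) \<and>
         (draw_prob Normal \<xi> k > 0 \<longleftrightarrow> loss_prob Normal \<xi> k < c_num \<xi> k) \<and>
         (draw_prob Misere \<xi> k > 0 \<longleftrightarrow> loss_prob Misere \<xi> k < c_hat \<xi> k)"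
proof -
  interpret normal: normal_jump_game \<xi> k by unfold_locales (use assms in auto)
  interpret misere: misere_jump_game \<xi> k by unfold_locales (use assms in auto)
  show ?thesis
    using normal.leaf_less_loss normal.loss_le_c[of k] normal.draw_prob_normal_pos_iff
      normal.meets_at_unique[OF assms(3)] misere.loss_le_c_hat misere.draw_prob_misere_pos_iff
    by blast
qed

end
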